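(* The divisor $D$ of any $f\in{\cal AE}$ is almost periodic. Moreover, for every $\varepsilon>0$ the set of numbers $\tau\in\mathbb{C}$ that are simultaneously $\varepsilon$-almost periods of $f$ and of $D$ is relatively dense in $\mathbb{C}$.
   Context: $\rho_S$ is the spherical metric. $\tau$ is an $\varepsilon$-almost period of a meromorphic $f$ if $\rho_S(f(z+\tau),f(z))<\varepsilon$ for all $z\in\mathbb{C}$; a nonconstant meromorphic $f$ is in ${\cal AE}$ if for every $\varepsilon>0$ its $\varepsilon$-almost periods form a relatively dense set. A set $E\subset\mathbb{C}$ is relatively dense if there is $L<\infty$ such that every disc of radius $L$ meets $E$. The divisor $D=((a_n),(b_n))$ of $f$ lists the zeros $a_n$ and poles $b_n$ with multiplicity. $\tau$ is an $\varepsilon$-almost period of $D$ if there are bijections $\sigma,\sigma':\mathbb{N}\to\mathbb{N}$ with $|a_n+\tau-a_{\sigma(n)}|<\varepsilon$ and $|b_n+\tau-b_{\sigma'(n)}|<\varepsilon$ for all $n$; $D$ is almost periodic if for every $\varepsilon>0$ its $\varepsilon$-almost periods form a relatively dense set. *)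

theory Defs
  imports "HOL-Analysis.Analysis"
begin

text \<open>Meromorphic functions on the whole plane are represented by a function
  f :: complex => complex whose poles are the points where f tends to infinity;
  at a pole the value f z is irrelevant and the function takes the value infinity
  on the Riemann sphere.\<close>

definition poles :: "(complex \<Rightarrow> complex) \<Rightarrow> complex set" where
  "poles f = {z. filterlim f at_infinity (at z)}"

definition meromorphic_C :: "(complex \<Rightarrow> complex) \<Rightarrow> bool" where
  "meromorphic_C f \<longleftrightarrow> (\<forall>z. \<not> z islimpt poles f) \<and> f holomorphic_on (UNIV - poles f)"

definition ext_val :: "(complex \<Rightarrow> complex) \<Rightarrow> complex \<Rightarrow> complex option" where
  "ext_val f z = (if z \<in> poles f then None else Some (f z))"

text \<open>Spherical (chordal) metric on the Riemann sphere (sphere of diameter 1).\<close>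
fun rho_S :: "complex option \<Rightarrow> complex option \<Rightarrow> real" where
  "rho_S None None = 0"
| "rho_S (Some a) None = 1 / sqrt (1 + (cmod a)\<^sup>2)"
| "rho_S None (Some b) = 1 / sqrt (1 + (cmod b)\<^sup>2)"
| "rho_S (Some a) (Some b) = cmod (a - b) / (sqrt (1 + (cmod a)\<^sup>2) * sqrt (1 + (cmod b)\<^sup>2))"

definition rel_dense :: "complex set \<Rightarrow> bool" where
  "rel_dense E \<longleftrightarrow> (\<exists>L::real. \<forall>c. ball c L \<inter> E \<noteq> {})"

definition almost_period :: "(complex \<Rightarrow> complex) \<Rightarrow> real \<Rightarrow> complex \<Rightarrow> bool" where
  "almost_period f \<epsilon> \<tau> \<longleftrightarrow> (\<forall>z. rho_S (ext_val f (z + \<tau>)) (ext_val f z) < \<epsilon>)"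

definition AE_class :: "(complex \<Rightarrow> complex) set" where
  "AE_class = {f. meromorphic_C f \<and> (\<exists>z w. ext_val f z \<noteq> ext_val f w)
                 \<and> (\<forall>\<epsilon>>0. rel_dense {\<tau>. almost_period f \<epsilon> \<tau>})}"

definition zero_mult :: "(complex \<Rightarrow> complex) \<Rightarrow> complex \<Rightarrow> nat" where
  "zero_mult f z = (THE n. \<exists>r>0. \<exists>g. g holomorphic_on ball z r \<and> g z \<noteq> 0 \<and>
                        (\<forall>w\<in>ball z r. f w = (w - z) ^ n * g w))"

definition pole_mult :: "(complex \<Rightarrow> complex) \<Rightarrow> complex \<Rightarrow> nat" where
  "pole_mult f z = (THE n. \<exists>r>0. \<exists>g. g holomorphic_on ball z r \<and> g z \<noteq> 0 \<and>
                        (\<forall>w\<in>ball z r - {z}. f w = g w / (w - z) ^ n))"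

text \<open>The divisor: zeros (resp. poles) listed with multiplicity; the k-th copy of the
  point z is the index (z,k), k < multiplicity.\<close>
definition zero_list :: "(complex \<Rightarrow> complex) \<Rightarrow> (complex \<times> nat) set" where
  "zero_list f = {(z, k). z \<notin> poles f \<and> f z = 0 \<and> k < zero_mult f z}"

definition pole_list :: "(complex \<Rightarrow> complex) \<Rightarrow> (complex \<times> nat) set" where
  "pole_list f = {(z, k). z \<in> poles f \<and> k < pole_mult f z}"

definition div_almost_period :: "(complex \<Rightarrow> complex) \<Rightarrow> real \<Rightarrow> complex \<Rightarrow> bool" where
  "div_almost_period f \<epsilon> \<tau> \<longleftrightarrow>
     (\<exists>\<sigma>. bij_betw \<sigma> (zero_list f) (zero_list f) \<and>
          (\<forall>a\<in>zero_list f. cmod (fst a + \<tau> - fst (\<sigma> a)) < \<epsilon>)) \<and>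
     (\<exists>\<sigma>'. bij_betw \<sigma>' (pole_list f) (pole_list f) \<and>
          (\<forall>b\<in>pole_list f. cmod (fst b + \<tau> - fst (\<sigma>' b)) < \<epsilon>))"

definition almost_periodic_divisor :: "(complex \<Rightarrow> complex) \<Rightarrow> bool" where
  "almost_periodic_divisor f \<longleftrightarrow> (\<forall>\<epsilon>>0. rel_dense {\<tau>. div_almost_period f \<epsilon> \<tau>})"

end

theory Submission
  imports Defs "HOL-Complex_Analysis.Complex_Analysis"
begin

text \<open>
  Let \<open>|f|\<^sub>S\<close> be the spherical distance of \<open>f\<close> to 0. By almost periodicity, \<open>f\<close> is uniformly
  continuous and \<open>|f|\<^sub>S\<close> is bounded below at some point of every disc of a fixed radius. If
  \<open>|f|\<^sub>S\<close> were very small at some point of every circle of radius less than \<open>\<epsilon>\<close> around \<open>c\<close>, then by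
  Montel's theorem it would be small on a disc around \<open>c\<close> of radius independent of \<open>c\<close>, and after
  finitely many such steps on a disc of that fixed radius, a contradiction. So for small \<open>\<eta>\<close> all
  components \<open>K\<close> of \<open>{|f|\<^sub>S < \<eta>}\<close> have diameter at most \<open>\<epsilon>\<close>. If \<open>\<tau>\<close> is an \<open>\<eta>/2\<close>-almost period, then
  by Rouche's theorem \<open>f\<close> has as many zeros in \<open>K\<close> as in \<open>K + \<tau>\<close>, and the sets \<open>K + \<tau>\<close> contain all
  zeros; matching the zeros in \<open>K\<close> with those in \<open>K + \<tau>\<close> gives the bijection. The poles of \<open>f\<close> are
  the zeros of \<open>1/f\<close>, which has the same almost periods.
\<close>

section \<open>Rouche's theorem on bounded connected open sets\<close>

text \<open>\<open>zero_mult\<close> is a definite description; identifying it with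
  \<open>zorder\<close> makes the library's argument principle applicable. The accumulation
  hypothesis excludes \<open>f\<close> vanishing identically near \<open>z\<close>, where no
  exponent satisfies the description.\<close>

lemma zero_mult_eq_zorder:
  assumes "f holomorphic_on V" "open V" "z \<in> V" "f z = 0" "\<not> z islimpt {w\<in>V. f w = 0}"
  shows "int (zero_mult f z) = zorder f z"
proof -
  obtain e0 where e0: "e0 > 0" "ball z e0 \<subseteq> V"
    using assms(2,3) openE by blast
  from assms(5) obtain T where T: "z \<in> T" "open T" "\<forall>w\<in>{w\<in>V. f w = 0}. w \<in> T \<longrightarrow> w = z"
    unfolding islimpt_def by metis
  then obtain e1 where e1: "e1 > 0" "ball z e1 \<subseteq> T"
    using openE by blast
  define e where "e = min e0 e1"
  have e: "e > 0" "ball z e \<subseteq> V" "ball z e \<subseteq> T"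
    using e0 e1 by (auto simp: e_def)
  then have nz: "\<And>w. w \<in> ball z e \<Longrightarrow> w \<noteq> z \<Longrightarrow> f w \<noteq> 0"
    using T(3) by blast
  have "z + of_real (e/2) \<in> ball z e" "z + of_real (e/2) \<noteq> z"
    using e by (auto simp: dist_norm)
  then have ex: "\<exists>w\<in>ball z e. f w \<noteq> 0"
    using nz by blast
  have pos: "zorder f z > 0" and
    *: "\<exists>r>0. cball z r \<subseteq> ball z e \<and> zor_poly f z holomorphic_on cball z r \<and>
        (\<forall>w\<in>cball z r. f w = zor_poly f z w * (w - z) ^ nat (zorder f z) \<and> zor_poly f z w \<noteq> 0)"
    using zorder_exist_zero[of f "ball z e" z] holomorphic_on_subset[OF assms(1) e(2)] e(1) ex assms(4)
    by auto
  then obtain r where r: "r > 0" "zor_poly f z holomorphic_on cball z r"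
    "\<And>w. w \<in> cball z r \<Longrightarrow> f w = zor_poly f z w * (w - z) ^ nat (zorder f z)"
    "\<And>w. w \<in> cball z r \<Longrightarrow> zor_poly f z w \<noteq> 0"
    by blast
  have "zero_mult f z = nat (zorder f z)"
    unfolding zero_mult_def
  proof (rule the_equality)
    show "\<exists>r>0. \<exists>g. g holomorphic_on ball z r \<and> g z \<noteq> 0 \<and>
      (\<forall>w\<in>ball z r. f w = (w - z) ^ nat (zorder f z) * g w)"
      by (rule exI[of _ r], intro conjI exI[of _ "zor_poly f z"])
         (use r in \<open>auto intro: holomorphic_on_subset simp: mult.commute\<close>)
  next
    fix n
    assume "\<exists>r>0. \<exists>g. g holomorphic_on ball z r \<and> g z \<noteq> 0 \<and>
      (\<forall>w\<in>ball z r. f w = (w - z) ^ n * g w)"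
    then obtain r' g where "r' > 0" "g holomorphic_on ball z r'" "g z \<noteq> 0"
      "\<And>w. w \<in> ball z r' \<Longrightarrow> f w = (w - z) ^ n * g w"
      by auto
    then have "zorder f z = int n"
      by (intro zorder_eqI[of "ball z r'" z g]) auto
    then show "n = nat (zorder f z)" by simp
  qed
  with pos show ?thesis by simp
qed

text \<open>Junk value 0 if there are infinitely many zeros in \<open>K\<close>.\<close>
definition zero_count :: "(complex \<Rightarrow> complex) \<Rightarrow> complex set \<Rightarrow> nat" where
  "zero_count f K = (\<Sum>z\<in>{z\<in>K. f z = 0}. zero_mult f z)"

lemma finite_not_islimpt:
  fixes A :: "'a::t1_space set"
  assumes "finite A" shows "\<not> x islimpt A"
  using assms by (simp add: islimpt_finite)

text \<open>The library version of Rouche's theorem weights every zero in the domain by a winding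
  number. For the circle this weight is 1 inside and 0 outside, which turns both weighted sums into
  \<open>zero_count\<close>. The larger disc of radius \<open>R\<close> is the common
  domain.\<close>

lemma zero_count_ball:
  assumes f: "f holomorphic_on ball c R" and g: "g holomorphic_on ball c R" and r: "0 < r" "r < R"
    and fin: "finite {z\<in>ball c R. f z = 0}" "finite {z\<in>ball c R. g z = 0}"
    and less: "\<And>z. z \<in> sphere c r \<Longrightarrow> cmod (g z - f z) < cmod (f z)"
  shows "zero_count f (ball c r) = zero_count g (ball c r)"
proof -
  have wind: "(\<Sum>p\<in>{z\<in>ball c R. h z = 0}. winding_number (circlepath c r) p * zorder h p)
      = of_nat (zero_count h (ball c r))"
    if h: "h holomorphic_on ball c R" "finite {z\<in>ball c R. h z = 0}"
      "\<And>z. z \<in> sphere c r \<Longrightarrow> h z \<noteq> 0" for h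
  proof -
    have "(\<Sum>p\<in>{z\<in>ball c R. h z = 0}. winding_number (circlepath c r) p * zorder h p)
      = (\<Sum>p\<in>{z\<in>ball c r. h z = 0}. winding_number (circlepath c r) p * zorder h p)"
    proof (rule sum.mono_neutral_right)
      show "\<forall>p\<in>{z \<in> ball c R. h z = 0} - {z \<in> ball c r. h z = 0}.
        winding_number (circlepath c r) p * complex_of_int (zorder h p) = 0"
      proof
        fix p assume p: "p \<in> {z \<in> ball c R. h z = 0} - {z \<in> ball c r. h z = 0}"
        \<comment> \<open>No zero lies on the circle, so a zero outside the open disc is outside the
          closed one.\<close>
        with h(3)[of p] have "p \<notin> cball c r"
          by (auto simp: dist_norm not_less)
        then have "winding_number (circlepath c r) p = 0"
          using r by (intro winding_number_zero_outside[of _ "cball c r"]) auto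
        then show "winding_number (circlepath c r) p * complex_of_int (zorder h p) = 0" by simp
      qed
    qed (use h(2) r in auto)
    also have "\<dots> = (\<Sum>p\<in>{z\<in>ball c r. h z = 0}. of_nat (zero_mult h p))"
    proof (rule sum.cong)
      fix p assume p: "p \<in> {z\<in>ball c r. h z = 0}"
      then have "winding_number (circlepath c r) p = 1"
        by (intro winding_number_circlepath) (auto simp: dist_norm norm_minus_commute)
      moreover have "int (zero_mult h p) = zorder h p"
        using p r by (intro zero_mult_eq_zorder[OF h(1)] finite_not_islimpt h) auto
      ultimately show "winding_number (circlepath c r) p * complex_of_int (zorder h p) = of_nat (zero_mult h p)"
        by (simp flip: \<open>int (zero_mult h p) = zorder h p\<close>)
    qed simp
    finally show ?thesis unfolding zero_count_def by simp
  qed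
  have "(\<Sum>p\<in>{p\<in>ball c R. f p + (g p - f p) = 0}. winding_number (circlepath c r) p * zorder (\<lambda>p. f p + (g p - f p)) p)
      = (\<Sum>p\<in>{p\<in>ball c R. f p = 0}. winding_number (circlepath c r) p * zorder f p)"
  proof (rule Rouche_theorem)
    show "\<forall>z\<in>path_image (circlepath c r). cmod (g z - f z) < cmod (f z)"
      using less r by simp
    show "\<forall>z. z \<notin> ball c R \<longrightarrow> winding_number (circlepath c r) z = 0"
      using r by (auto intro!: winding_number_zero_outside[of _ "ball c R"])
    show "path_image (circlepath c r) \<subseteq> ball c R"
      using r by auto
    show "(\<lambda>p. g p - f p) holomorphic_on ball c R"
      by (intro holomorphic_intros f g)
  qed (use f fin in simp_all)
  then have "(\<Sum>p\<in>{p\<in>ball c R. g p = 0}. winding_number (circlepath c r) p * zorder g p)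
      = (\<Sum>p\<in>{p\<in>ball c R. f p = 0}. winding_number (circlepath c r) p * zorder f p)"
    by simp
  moreover have "f z \<noteq> 0" "g z \<noteq> 0" if "z \<in> sphere c r" for z
    using less[OF that] by auto
  ultimately have "complex_of_nat (zero_count g (ball c r)) = of_nat (zero_count f (ball c r))"
    using wind[OF f] wind[OF g] fin by simp
  then show ?thesis by (metis of_nat_eq_iff)
qed

text \<open>Infinitely many zeros would accumulate at a zero in the compact closure, which cannot
  lie on the frontier. The identity theorem then makes \<open>f\<close> vanish on \<open>K\<close>
  and, by continuity, on the frontier, which is nonempty because \<open>K\<close> is bounded and
  nonempty.\<close>

lemma finite_zeros_of_frontier_nonzero:
  assumes f: "f holomorphic_on V" "open V" "closure K \<subseteq> V"
    and K: "open K" "connected K" "bounded K"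
    and nz: "\<And>z. z \<in> frontier K \<Longrightarrow> f z \<noteq> 0"
  shows "finite {z\<in>closure K. f z = 0}"
proof (rule ccontr)
  assume inf: "infinite {z\<in>closure K. f z = 0}"
  have KV: "K \<subseteq> V" using f(3) closure_subset by blast
  have comp: "compact (closure K)" using K(3) by simp
  have split: "closure K = K \<union> frontier K"
    using K(1) closure_subset[of K] by (auto simp: frontier_def interior_open)
  obtain z where z: "z \<in> closure K" "z islimpt {z\<in>closure K. f z = 0}"
    using comp inf unfolding compact_eq_Bolzano_Weierstrass by blast
  have cont: "continuous_on (closure K) f"
    using f holomorphic_on_imp_continuous_on holomorphic_on_subset by blast
  have "closed {z\<in>closure K. f z = 0}"
    using continuous_closed_preimage_constant[OF cont] by auto
  then have "f z = 0" using z(2) closed_limpt by blast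
  with z split nz have zK: "z \<in> K" by auto
  have "{z\<in>closure K. f z = 0} = {z\<in>K. f z = 0}" using split nz by auto
  then have "f w = 0" if "w \<in> K" for w
    using that zK z(2) K
    by (intro analytic_continuation[of f K "{z\<in>K. f z = 0}" z w] holomorphic_on_subset[OF f(1) KV]) auto
  then have 0: "f w = 0" if "w \<in> closure K" for w
    using continuous_constant_on_closure[OF cont _ that, of 0] by blast
  have "K \<noteq> UNIV" using K(3) not_bounded_UNIV by blast
  then have "frontier K \<noteq> {}" using zK frontier_eq_empty by blast
  with 0 nz split show False by blast
qed

text \<open>Surround the finitely many zeros by disjoint small discs. Off these discs
  \<open>f\<close> is bounded below by some \<open>e\<close>, so a perturbation by less than
  \<open>e\<close> has no zero there, and Rouche's theorem on each disc preserves the count inside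
  it.\<close>

lemma zero_count_locally_constant:
  assumes f: "f holomorphic_on V" "open V" "closure K \<subseteq> V"
    and K: "open K" "connected K" "bounded K"
    and nz: "\<And>z. z \<in> frontier K \<Longrightarrow> f z \<noteq> 0"
  obtains e where "e > 0" "\<And>h. h holomorphic_on V \<Longrightarrow> (\<And>z. z \<in> closure K \<Longrightarrow> cmod (h z - f z) < e)
     \<Longrightarrow> zero_count h K = zero_count f K"
proof -
  define Z where "Z = {z\<in>K. f z = 0}"
  have clK: "K \<subseteq> closure K" by (rule closure_subset)
  have split: "closure K = K \<union> frontier K"
    using K(1) closure_subset[of K] by (auto simp: frontier_def interior_open)
  have finZ: "finite Z"
    by (rule finite_subset[OF _ finite_zeros_of_frontier_nonzero[OF assms]]) (use clK in \<open>auto simp: Z_def\<close>)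
  \<comment> \<open>Each of these finitely many conditions holds for all small positive radii, hence
    all hold for a common one.\<close>
  have "\<exists>r>0. \<forall>z\<in>Z. ball z r \<subseteq> K \<and> (\<forall>w\<in>Z. w \<noteq> z \<longrightarrow> r \<le> dist z w / 2)"
    (is "\<exists>r>0. \<forall>z\<in>Z. ?P z r")
  proof -
    have "\<forall>\<^sub>F r in at_right 0. ?P z r" if "z \<in> Z" for z
    proof -
      have "z \<in> K" using that by (simp add: Z_def)
      then obtain e where e: "e > 0" "ball z e \<subseteq> K" using K(1) openE by blast
      have "\<forall>\<^sub>F r in at_right 0. r < e"
        using e(1) by (intro eventually_at_rightI[of 0 e]) auto
      then have "\<forall>\<^sub>F r in at_right 0. ball z r \<subseteq> K"
        by eventually_elim (use e(2) in auto)
      moreover have "\<forall>\<^sub>F r in at_right 0. \<forall>w\<in>Z. w \<noteq> z \<longrightarrow> r \<le> dist z w / 2"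
      proof (rule eventually_ball_finite[OF finZ], rule ballI)
        fix w
        show "\<forall>\<^sub>F r in at_right 0. w \<noteq> z \<longrightarrow> r \<le> dist z w / 2"
        proof (cases "w = z")
          case False
          then have "0 < dist z w / 2" by simp
          then have "\<forall>\<^sub>F r in at_right 0. r < dist z w / 2"
            by (intro eventually_at_rightI[of 0 "dist z w / 2"]) auto
          then show ?thesis by eventually_elim simp
        qed simp
      qed
      ultimately show ?thesis by eventually_elim auto
    qed
    then have "\<forall>\<^sub>F r in at_right 0. \<forall>z\<in>Z. ?P z r"
      using finZ by (intro eventually_ball_finite) auto
    moreover have "\<forall>\<^sub>F r in at_right (0::real). r > 0" by (rule eventually_at_right_less)
    ultimately have "\<forall>\<^sub>F r in at_right 0. r > 0 \<and> (\<forall>z\<in>Z. ?P z r)" by eventually_elim auto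
    then show ?thesis using eventually_happens'[OF trivial_limit_at_right_real] by blast
  qed
  then obtain R where R: "R > 0" "\<And>z. z \<in> Z \<Longrightarrow> ball z R \<subseteq> K"
    "\<And>z w. z \<in> Z \<Longrightarrow> w \<in> Z \<Longrightarrow> w \<noteq> z \<Longrightarrow> R \<le> dist z w / 2" by metis
  \<comment> \<open>Halving leaves room: the disc of radius \<open>R\<close> is the outer disc
    required by \<open>zero_count_ball\<close>, and a circle of radius \<open>r\<close> about one
    zero avoids the discs about the others.\<close>
  define r where "r = R / 2"
  have r: "0 < r" "r < R" using R(1) by (auto simp: r_def)
  define C where "C = closure K - (\<Union>z\<in>Z. ball z r)"
  have compC: "compact C" unfolding C_def using K(3) by (intro compact_diff) auto
  have contC: "continuous_on C f"
    by (rule continuous_on_subset[of V]) (use f in \<open>auto simp: C_def holomorphic_on_imp_continuous_on\<close>)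
  have nzC: "f z \<noteq> 0" if "z \<in> C" for z
  proof
    assume "f z = 0"
    moreover have "z \<in> closure K" using that by (simp add: C_def)
    ultimately have "z \<in> Z" using split nz[of z] by (auto simp: Z_def)
    then have "z \<in> (\<Union>z\<in>Z. ball z r)" using r(1) by (intro UN_I[of z]) auto
    with that show False by (auto simp: C_def)
  qed
  obtain e where e: "e > 0" "\<And>z. z \<in> C \<Longrightarrow> e \<le> cmod (f z)"
  proof (cases "C = {}")
    case True
    then show ?thesis using that[of 1] by auto
  next
    case False
    then obtain x where x: "x \<in> C" "\<And>y. y \<in> C \<Longrightarrow> cmod (f x) \<le> cmod (f y)"
      using continuous_attains_inf[OF compC False, of "\<lambda>z. cmod (f z)"] contC
      by (auto intro: continuous_intros)
    then show ?thesis using that[of "cmod (f x)"] nzC by auto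
  qed
  show ?thesis
  proof (rule that[OF e(1)])
    fix h assume h: "h holomorphic_on V" and close: "\<And>z. z \<in> closure K \<Longrightarrow> cmod (h z - f z) < e"
    have hC: "h z \<noteq> 0" if "z \<in> C" for z
      using e(2)[OF that] close[of z] that by (auto simp: C_def)
    have "frontier K \<subseteq> C"
    proof -
      have "ball z r \<inter> frontier K = {}" if "z \<in> Z" for z
      proof -
        have "ball z r \<subseteq> K"
          using R(2)[OF that] subset_ball[of r R z] r by simp
        then show ?thesis using K(1) by (auto simp: frontier_def interior_open)
      qed
      then show ?thesis using split by (auto simp: C_def)
    qed
    then have nzh: "h z \<noteq> 0" if "z \<in> frontier K" for z
      using hC that by auto
    have finh: "finite {z\<in>closure K. h z = 0}"
      by (rule finite_zeros_of_frontier_nonzero[OF h f(2,3) K nzh])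
    have KV: "K \<subseteq> V" using f(3) clK by blast
    have ballR: "zero_count f (ball z r) = zero_count h (ball z r)" if z: "z \<in> Z" for z
    proof (rule zero_count_ball[OF _ _ r])
      have sub: "ball z R \<subseteq> K" using R(2) z by blast
      then show "f holomorphic_on ball z R" "h holomorphic_on ball z R"
        using f(1) h KV by (auto intro: holomorphic_on_subset)
      show "finite {z' \<in> ball z R. f z' = 0}"
        by (rule finite_subset[OF _ finZ]) (use sub in \<open>auto simp: Z_def\<close>)
      show "finite {z' \<in> ball z R. h z' = 0}"
        by (rule finite_subset[OF _ finh]) (use sub clK in \<open>auto\<close>)
      fix w assume w: "w \<in> sphere z r"
      have "w \<in> ball z R" using w r by simp
      with sub have "w \<in> K" by blast
      moreover have "w \<notin> ball y r" if "y \<in> Z" for y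
      proof (cases "y = z")
        case False
        have "2 * R \<le> dist z y" using R(3)[OF z that False] by simp
        also have "\<dots> \<le> dist z w + dist y w" using dist_triangle[of z y w] by (simp add: dist_commute)
        finally show ?thesis using w r by simp
      qed (use w in auto)
      ultimately have "w \<in> C" using clK by (auto simp: C_def)
      then show "cmod (h w - f w) < cmod (f w)"
        using e(2)[of w] close[of w] by (simp add: C_def)
    qed
    \<comment> \<open>Stated for any \<open>u\<close> without zeros in \<open>C\<close>, so that it
      splits the count of \<open>f\<close> and of \<open>h\<close> over the same discs.\<close>
    have count: "zero_count u K = (\<Sum>z\<in>Z. zero_count u (ball z r))"
      if u: "\<And>z. z \<in> C \<Longrightarrow> u z \<noteq> 0" "finite {z\<in>K. u z = 0}" for u
    proof -
      have eq: "{w\<in>K. u w = 0} = (\<Union>z\<in>Z. {w\<in>ball z r. u w = 0})"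
      proof (intro equalityI subsetI)
        fix w assume "w \<in> {w\<in>K. u w = 0}"
        then show "w \<in> (\<Union>z\<in>Z. {w\<in>ball z r. u w = 0})"
          using u(1)[of w] clK by (auto simp: C_def)
      next
        fix w assume "w \<in> (\<Union>z\<in>Z. {w\<in>ball z r. u w = 0})"
        then obtain z where "z \<in> Z" "w \<in> ball z r" "u w = 0" by blast
        moreover have "ball z r \<subseteq> ball z R" using r by (intro subset_ball) simp
        ultimately show "w \<in> {w\<in>K. u w = 0}" using R(2)[of z] by blast
      qed
      show ?thesis unfolding zero_count_def eq
      proof (rule sum.UNION_disjoint[OF finZ])
        show "\<forall>i\<in>Z. finite {w \<in> ball i r. u w = 0}"
        proof
          fix i assume "i \<in> Z"
          then have "{w \<in> ball i r. u w = 0} \<subseteq> {w\<in>K. u w = 0}"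
            using eq by blast
          then show "finite {w \<in> ball i r. u w = 0}" using u(2) finite_subset by blast
        qed
        show "\<forall>i\<in>Z. \<forall>j\<in>Z. i \<noteq> j \<longrightarrow> {w \<in> ball i r. u w = 0} \<inter> {w \<in> ball j r. u w = 0} = {}"
        proof (intro ballI impI)
          fix i j assume ij: "i \<in> Z" "j \<in> Z" "i \<noteq> j"
          have "2 * R \<le> dist i j" using R(3)[of i j] ij by simp
          then have "ball i r \<inter> ball j r = {}"
            using r by (intro disjoint_ballI) (auto simp: r_def)
          then show "{w \<in> ball i r. u w = 0} \<inter> {w \<in> ball j r. u w = 0} = {}" by auto
        qed
      qed
    qed
    have "finite {z\<in>K. h z = 0}" by (rule finite_subset[OF _ finh]) (use clK in auto)
    then show "zero_count h K = zero_count f K"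
      using count[OF hC] count[OF nzC] finZ ballR by (simp add: Z_def)
  qed
qed

text \<open>This form is meant for components of sublevel sets, whose frontier need not be a curve,
  so that no contour or winding number enters the statement.\<close>

theorem Rouche_bounded_open:
  assumes f: "f holomorphic_on V" and g: "g holomorphic_on V"
    and V: "open V" "closure K \<subseteq> V" and K: "open K" "connected K" "bounded K"
    and less: "\<And>z. z \<in> frontier K \<Longrightarrow> cmod (g z - f z) < cmod (f z)"
  shows "zero_count f K = zero_count g K"
proof -
  \<comment> \<open>The zero count is locally constant along the segment from \<open>f\<close> to \<open>g\<close>.\<close>
  define h where "h = (\<lambda>(t::real) z. f z + of_real t * (g z - f z))"
  have holo: "h t holomorphic_on V" for t
    unfolding h_def by (intro holomorphic_intros f g)
  have nz: "h t z \<noteq> 0" if "t \<in> {0..1}" "z \<in> frontier K" for t z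
  proof
    assume "h t z = 0"
    then have "cmod (f z) = cmod (of_real t * (g z - f z))"
      by (metis add_eq_0_iff h_def norm_minus_cancel)
    also have "\<dots> \<le> 1 * cmod (g z - f z)"
      unfolding norm_mult using that by (intro mult_right_mono) auto
    finally show False using less[OF that(2)] by simp
  qed
  have "continuous_on (closure K) (\<lambda>z. g z - f z)"
    using holomorphic_on_imp_continuous_on[OF f] holomorphic_on_imp_continuous_on[OF g] V(2)
    by (intro continuous_intros) (auto intro: continuous_on_subset)
  then have "bounded ((\<lambda>z. g z - f z) ` closure K)"
    using K(3) by (intro compact_imp_bounded compact_continuous_image) auto
  then obtain B where B: "B > 0" "\<And>z. z \<in> closure K \<Longrightarrow> cmod (g z - f z) \<le> B"
    unfolding bounded_pos by auto
  have "zero_count (h 0) K = zero_count (h 1) K"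
  proof (rule connected_local_const[of "{0..1::real}" 0 1 "\<lambda>t. zero_count (h t) K"])
    show "\<forall>t\<in>{0..1}. \<forall>\<^sub>F s in at t within {0..1}. zero_count (h t) K = zero_count (h s) K"
    proof
      fix t :: real assume t: "t \<in> {0..1}"
      obtain e where e: "e > 0" "\<And>u. u holomorphic_on V \<Longrightarrow>
          (\<And>z. z \<in> closure K \<Longrightarrow> cmod (u z - h t z) < e) \<Longrightarrow> zero_count u K = zero_count (h t) K"
        using zero_count_locally_constant[OF holo V K nz[OF t]] by blast
      \<comment> \<open>Since \<open>B\<close> bounds \<open>g - f\<close> on the closure, moving
        the parameter by less than \<open>e / B\<close> changes \<open>h\<close> there by less than
        \<open>e\<close>.\<close>
      have "\<forall>\<^sub>F s in at t within {0..1}. dist s t < e / B"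
        unfolding eventually_at using e(1) B(1) by (intro exI[of _ "e / B"]) auto
      then show "\<forall>\<^sub>F s in at t within {0..1}. zero_count (h t) K = zero_count (h s) K"
      proof eventually_elim
        fix s assume s: "dist s t < e / B"
        show "zero_count (h t) K = zero_count (h s) K"
        proof (rule e(2)[symmetric, OF holo])
          fix z assume z: "z \<in> closure K"
          have "h s z - h t z = of_real (s - t) * (g z - f z)"
            by (simp add: h_def algebra_simps)
          then have "cmod (h s z - h t z) = dist s t * cmod (g z - f z)"
            by (simp only: norm_mult norm_of_real dist_real_def)
          also have "\<dots> \<le> dist s t * B"
            using B(2)[OF z] by (intro mult_left_mono) auto
          also have "\<dots> < e" using s B(1) by (simp add: field_simps)
          finally show "cmod (h s z - h t z) < e" .
        qed
      qed
    qed
  qed auto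
  moreover have "h 0 = f" "h 1 = g" by (auto simp: h_def)
  ultimately show ?thesis by simp
qed

section \<open>The spherical picture of an almost periodic function\<close>

text \<open>Stereographic projection onto the sphere of diameter 1 through 0; it turns \<open>rho_S\<close> into a
  Euclidean distance.\<close>
definition sphere_pt :: "complex option \<Rightarrow> complex \<times> real" where
  "sphere_pt x = (case x of None \<Rightarrow> (0, 1)
     | Some a \<Rightarrow> (a /\<^sub>R (1 + (cmod a)\<^sup>2), (cmod a)\<^sup>2 / (1 + (cmod a)\<^sup>2)))"

lemma one_plus_square_pos: "0 < 1 + (x::real)\<^sup>2"
  by (smt (verit) zero_le_power2)

text \<open>Both sides are nonnegative, so their squares are compared. Over the common denominator
  \<open>A * B\<close> this becomes a polynomial identity modulo the relations expressing
  \<open>A\<close> and \<open>B\<close> by real and imaginary parts.\<close>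

lemma dist_sphere_pt_Some:
  "dist (sphere_pt (Some a)) (sphere_pt (Some b)) = rho_S (Some a) (Some b)"
proof -
  define A B where "A = 1 + (cmod a)\<^sup>2" and "B = 1 + (cmod b)\<^sup>2"
  have pos: "A > 0" "B > 0" by (simp_all only: A_def B_def one_plus_square_pos)
  have A: "(Re a)\<^sup>2 + (Im a)\<^sup>2 = A - 1" and B: "(Re b)\<^sup>2 + (Im b)\<^sup>2 = B - 1"
    by (auto simp: A_def B_def cmod_power2)
  have "(dist (sphere_pt (Some a)) (sphere_pt (Some b)))\<^sup>2
      = (cmod (a /\<^sub>R A - b /\<^sub>R B))\<^sup>2 + ((A - 1) / A - (B - 1) / B)\<^sup>2"
    by (simp add: sphere_pt_def norm_Pair dist_norm A_def B_def)
  also have "\<dots> = (Re a / A - Re b / B)\<^sup>2 + (Im a / A - Im b / B)\<^sup>2 + ((A - 1) / A - (B - 1) / B)\<^sup>2"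
    by (simp add: cmod_power2 divide_inverse mult.commute)
  also have "\<dots> = ((Re a * B - Re b * A)\<^sup>2 + (Im a * B - Im b * A)\<^sup>2 + ((A - 1) * B - (B - 1) * A)\<^sup>2) / (A * B)\<^sup>2"
    using pos by (simp add: diff_frac_eq power_divide add_divide_distrib)
  also have "(Re a * B - Re b * A)\<^sup>2 + (Im a * B - Im b * A)\<^sup>2 + ((A - 1) * B - (B - 1) * A)\<^sup>2
      = (A * B) * ((Re a - Re b)\<^sup>2 + (Im a - Im b)\<^sup>2)"
    using A B by algebra
  also have "\<dots> / (A * B)\<^sup>2 = ((Re a - Re b)\<^sup>2 + (Im a - Im b)\<^sup>2) / (A * B)"
    using pos by (simp add: power2_eq_square)
  also have "\<dots> = (rho_S (Some a) (Some b))\<^sup>2"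
    using pos by (simp add: power_divide power_mult_distrib cmod_power2[of "a - b"] flip: A_def B_def)
  finally show ?thesis
    by (rule power2_eq_imp_eq) auto
qed

lemma dist_sphere_pt_None:
  "dist (sphere_pt (Some a)) (sphere_pt None) = 1 / sqrt (1 + (cmod a)\<^sup>2)"
proof -
  define A where "A = 1 + (cmod a)\<^sup>2"
  have pos: "A > 0" by (simp only: A_def one_plus_square_pos)
  have "(dist (sphere_pt (Some a)) (sphere_pt None))\<^sup>2 = (cmod a / A)\<^sup>2 + ((cmod a)\<^sup>2 / A - 1)\<^sup>2"
    using pos by (simp add: sphere_pt_def dist_Pair_Pair A_def dist_real_def divide_inverse mult.commute)
  also have "(cmod a)\<^sup>2 / A - 1 = - (1 / A)"
    using pos by (simp add: A_def field_simps)
  also have "(cmod a / A)\<^sup>2 + (- (1 / A))\<^sup>2 = ((cmod a)\<^sup>2 + 1) / A\<^sup>2"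
    by (simp add: power_divide add_divide_distrib)
  also have "(cmod a)\<^sup>2 + 1 = A" by (simp add: A_def)
  also have "A / A\<^sup>2 = 1 / A"
    using pos by (simp add: power2_eq_square)
  also have "\<dots> = (1 / sqrt A)\<^sup>2" using pos by (simp add: power_divide)
  finally have "dist (sphere_pt (Some a)) (sphere_pt None) = 1 / sqrt A"
    by (rule power2_eq_imp_eq) (use pos in auto)
  then show ?thesis by (simp add: A_def)
qed

lemma dist_sphere_pt: "dist (sphere_pt x) (sphere_pt y) = rho_S x y"
  using dist_sphere_pt_Some dist_sphere_pt_None
  by (cases x; cases y) (simp_all add: dist_commute)

lemma sphere_pt_0 [simp]: "sphere_pt (Some 0) = 0"
  by (simp add: sphere_pt_def zero_prod_def)

lemma norm_sphere_pt_Some: "norm (sphere_pt (Some a)) = cmod a / sqrt (1 + (cmod a)\<^sup>2)"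
  using dist_sphere_pt[of "Some a" "Some 0"] by simp

lemma norm_sphere_pt_None [simp]: "norm (sphere_pt None) = 1"
  by (simp add: sphere_pt_def norm_Pair)

lemma norm_sphere_pt_le: "norm (sphere_pt (Some a)) \<le> cmod a"
proof -
  have "1 \<le> sqrt (1 + (cmod a)\<^sup>2)" by simp
  then have "cmod a / sqrt (1 + (cmod a)\<^sup>2) \<le> cmod a / 1"
    by (intro divide_left_mono) (auto simp: one_plus_square_pos)
  then show ?thesis by (simp add: norm_sphere_pt_Some)
qed

text \<open>Close to 0, spherical smallness controls the modulus: the bound 1/2 forces
  \<open>cmod a \<le> 1\<close>, hence the denominator in \<open>norm_sphere_pt_Some\<close> is at
  most 2.\<close>

lemma norm_sphere_pt_le_half:
  assumes "norm (sphere_pt (Some a)) \<le> 1/2"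
  shows "cmod a \<le> 1" "cmod a \<le> 2 * norm (sphere_pt (Some a))"
proof -
  have pos: "0 < 1 + (cmod a)\<^sup>2" by (rule one_plus_square_pos)
  have "(norm (sphere_pt (Some a)))\<^sup>2 \<le> (1/2)\<^sup>2"
    using assms by (intro power_mono) auto
  then have "(cmod a)\<^sup>2 / (1 + (cmod a)\<^sup>2) \<le> 1/4"
    using pos by (simp add: norm_sphere_pt_Some power_divide)
  then have "(cmod a)\<^sup>2 \<le> 1"
    using pos by (simp add: pos_divide_le_eq)
  then show 1: "cmod a \<le> 1" by (simp add: power_le_one_iff abs_square_le_1)
  have "sqrt (1 + (cmod a)\<^sup>2) \<le> sqrt 4"
    using \<open>(cmod a)\<^sup>2 \<le> 1\<close> by (intro real_sqrt_le_mono) simp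
  then have "sqrt (1 + (cmod a)\<^sup>2) \<le> 2" by simp
  then have "cmod a * sqrt (1 + (cmod a)\<^sup>2) \<le> cmod a * 2"
    by (rule mult_left_mono) simp
  then show "cmod a \<le> 2 * norm (sphere_pt (Some a))"
    using pos by (simp add: norm_sphere_pt_Some pos_le_divide_eq mult.commute)
qed

lemma tendsto_sphere_pt_at_infinity: "((\<lambda>a. sphere_pt (Some a)) \<longlongrightarrow> sphere_pt None) at_infinity"
proof (rule tendstoI)
  fix e :: real assume e: "e > 0"
  have "\<forall>\<^sub>F a::complex in at_infinity. norm a \<ge> 2 / e"
    by (rule eventually_at_infinityI[of "2/e"])
  then show "\<forall>\<^sub>F a in at_infinity. dist (sphere_pt (Some a)) (sphere_pt None) < e"
  proof eventually_elim
    fix a :: complex assume a: "norm a \<ge> 2 / e"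
    moreover have "2 / e > 0" using e by simp
    ultimately have pos: "norm a > 0" by linarith
    have "cmod a \<le> sqrt (1 + (cmod a)\<^sup>2)" by (simp add: real_le_rsqrt)
    then have "1 / sqrt (1 + (cmod a)\<^sup>2) \<le> 1 / cmod a"
      using pos by (intro divide_left_mono) (auto simp: one_plus_square_pos)
    also have "\<dots> < e"
    proof -
      have "2 \<le> norm a * e" using a e by (simp add: pos_divide_le_eq)
      then show ?thesis using pos by (simp add: pos_divide_less_eq mult.commute)
    qed
    finally show "dist (sphere_pt (Some a)) (sphere_pt None) < e"
      by (simp add: dist_sphere_pt_None)
  qed
qed

text \<open>For meromorphic \<open>f\<close> this map is continuous at poles too, where
  \<open>f z\<close> itself is an arbitrary value; its norm is the spherical distance of
  \<open>f\<close> to 0.\<close>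

definition spherical :: "(complex \<Rightarrow> complex) \<Rightarrow> complex \<Rightarrow> complex \<times> real" where
  "spherical f z = sphere_pt (ext_val f z)"

lemma spherical_nonpole: "z \<notin> poles f \<Longrightarrow> spherical f z = sphere_pt (Some (f z))"
  by (simp add: spherical_def ext_val_def)

lemma spherical_pole: "z \<in> poles f \<Longrightarrow> spherical f z = sphere_pt None"
  by (simp add: spherical_def ext_val_def)

lemma nonpole_if_norm_spherical_less: "norm (spherical f z) < 1 \<Longrightarrow> z \<notin> poles f"
  by (cases "z \<in> poles f") (simp_all add: spherical_pole)

lemma almost_period_spherical:
  "almost_period f e \<tau> \<longleftrightarrow> (\<forall>z. dist (spherical f (z + \<tau>)) (spherical f z) < e)"
  by (simp add: almost_period_def spherical_def dist_sphere_pt)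

lemma open_nonpoles: "meromorphic_C f \<Longrightarrow> open (- poles f)"
  unfolding meromorphic_C_def by (intro open_Compl) (simp add: closed_limpt)

lemma continuous_spherical:
  assumes f: "meromorphic_C f"
  shows "continuous_on A (spherical f)"
proof (rule continuous_at_imp_continuous_on, rule ballI)
  fix z
  show "isCont (spherical f) z"
  proof (cases "z \<in> poles f")
    case True
    have "\<not> z islimpt poles f" using f by (simp add: meromorphic_C_def)
    \<comment> \<open>Poles are isolated, so near \<open>z\<close> only the finite values of
      \<open>f\<close> matter, and these tend to infinity.\<close>
    then have "\<forall>\<^sub>F w in at z. w \<notin> poles f" by (simp add: islimpt_iff_eventually)
    then have ev: "\<forall>\<^sub>F w in at z. sphere_pt (Some (f w)) = spherical f w"
      by eventually_elim (simp add: spherical_nonpole)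
    have "filterlim f at_infinity (at z)" using True by (simp add: poles_def)
    then have "((\<lambda>w. sphere_pt (Some (f w))) \<longlongrightarrow> sphere_pt None) (at z)"
      by (rule filterlim_compose[OF tendsto_sphere_pt_at_infinity])
    then show ?thesis
      unfolding isCont_def spherical_pole[OF True] by (rule tendsto_cong[OF ev, THEN iffD1])
  next
    case False
    have op: "open (- poles f)" by (rule open_nonpoles[OF f])
    have contf: "continuous_on (- poles f) f"
      using f by (simp add: meromorphic_C_def Compl_eq_Diff_UNIV holomorphic_on_imp_continuous_on)
    have "1 + (cmod a)\<^sup>2 \<noteq> 0" for a
      using one_plus_square_pos[of "cmod a"] by simp
    then have "continuous_on (- poles f) (\<lambda>w. sphere_pt (Some (f w)))"
      unfolding sphere_pt_def option.case
      by (intro continuous_intros contf) auto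
    then have "continuous_on (- poles f) (spherical f)"
      by (rule continuous_on_eq) (simp add: spherical_nonpole)
    then show ?thesis using False by (simp add: continuous_on_eq_continuous_at[OF op])
  qed
qed

section \<open>First consequences of almost periodicity\<close>

lemma
  assumes "f \<in> AE_class"
  shows AE_class_meromorphic: "meromorphic_C f"
    and AE_class_almost_periods: "e > 0 \<Longrightarrow> \<exists>L>0. \<forall>c. \<exists>\<tau>\<in>ball c L. almost_period f e \<tau>"
proof -
  have *: "meromorphic_C f \<and> (\<forall>e>0. rel_dense {\<tau>. almost_period f e \<tau>})"
    using assms unfolding AE_class_def by (elim CollectE conjE) (intro conjI)
  then show "meromorphic_C f" by (rule conjunct1)
  assume "e > 0"
  with * have "rel_dense {\<tau>. almost_period f e \<tau>}" by (elim conjE allE[of _ e]) (rule mp)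
  then obtain L where L: "\<forall>c. ball c L \<inter> {\<tau>. almost_period f e \<tau>} \<noteq> {}"
    unfolding rel_dense_def by (elim exE)
  \<comment> \<open>\<open>rel_dense\<close> puts no sign on \<open>L\<close>, but a ball of
    nonpositive radius is empty and meets nothing.\<close>
  have "L > 0"
  proof (rule ccontr)
    assume "\<not> L > 0"
    then have "ball 0 L = ({} :: complex set)" by (simp only: ball_eq_empty not_less)
    with spec[OF L, of 0] show False by simp
  qed
  moreover have "\<forall>c. \<exists>\<tau>\<in>ball c L. almost_period f e \<tau>"
  proof
    fix c
    from spec[OF L, of c] show "\<exists>\<tau>\<in>ball c L. almost_period f e \<tau>"
      by (simp only: disjoint_iff mem_Collect_eq not_all not_imp not_not) (simp only: Bex_def)
  qed
  ultimately show "\<exists>L>0. \<forall>c. \<exists>\<tau>\<in>ball c L. almost_period f e \<tau>" by (intro exI conjI)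
qed

text \<open>An almost period carries any two nearby points into one fixed compact disc, where
  continuity is uniform. The two translations and the comparison in the disc cost \<open>e/3\<close>
  each.\<close>

lemma AE_class_uniformly_continuous:
  assumes f: "f \<in> AE_class"
  shows "uniformly_continuous_on UNIV (spherical f)"
  unfolding uniformly_continuous_on_def
proof (intro allI impI)
  fix e :: real assume e: "e > 0"
  obtain L where L: "L > 0" "\<And>c. \<exists>\<tau>\<in>ball c L. almost_period f (e/3) \<tau>"
    using AE_class_almost_periods[OF f, of "e/3"] e by auto
  have "uniformly_continuous_on (cball 0 (L + 1)) (spherical f)"
    using AE_class_meromorphic[OF f] by (intro compact_uniformly_continuous continuous_spherical) auto
  then obtain d where d: "d > 0" "\<And>z w. z \<in> cball 0 (L + 1) \<Longrightarrow> w \<in> cball 0 (L + 1) \<Longrightarrow>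
     dist w z < d \<Longrightarrow> dist (spherical f w) (spherical f z) < e/3"
    unfolding uniformly_continuous_on_def using e by (elim allE[of _ "e/3"]) auto
  show "\<exists>d>0. \<forall>x\<in>UNIV. \<forall>x'\<in>UNIV. dist x' x < d \<longrightarrow> dist (spherical f x') (spherical f x) < e"
  \<comment> \<open>The bound 1 keeps the second translated point in the disc of radius
    \<open>L + 1\<close> once the first is within \<open>L\<close>.\<close>
  proof (intro exI[of _ "min d 1"] conjI ballI impI)
    fix z w :: complex assume zw: "dist w z < min d 1"
    obtain \<tau> where \<tau>: "\<tau> \<in> ball z L" "almost_period f (e/3) \<tau>" using L(2) by blast
    have per: "dist (spherical f u) (spherical f (u - \<tau>)) < e/3" for u
      using \<tau>(2)[unfolded almost_period_spherical, THEN spec, of "u - \<tau>"] by simp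
    have 1: "norm (z - \<tau>) < L" using \<tau>(1) by (simp add: dist_norm)
    have "norm (w - \<tau>) \<le> norm (z - \<tau>) + dist w z"
      using norm_triangle_ineq[of "z - \<tau>" "w - z"] by (simp add: dist_norm)
    with 1 zw have 2: "norm (w - \<tau>) < L + 1" by simp
    have "dist (w - \<tau>) (z - \<tau>) < d" using zw by (simp add: dist_norm)
    then have "dist (spherical f (w - \<tau>)) (spherical f (z - \<tau>)) < e/3"
      using 1 2 by (intro d) auto
    with per[of w] per[of z] show "dist (spherical f w) (spherical f z) < e"
      using dist_triangle[of "spherical f w" "spherical f z" "spherical f (w - \<tau>)"]
        dist_triangle[of "spherical f (w - \<tau>)" "spherical f z" "spherical f (z - \<tau>)"]
      by (simp add: dist_commute)
  qed (use d in auto)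
qed

text \<open>By nonconstancy \<open>f\<close> is not 0 at some \<open>u\<close>. Almost periods whose
  error is half the norm at \<open>u\<close> carry \<open>u\<close> into every disc of radius
  \<open>L\<close>, and at least half of that norm survives.\<close>

lemma AE_class_not_uniformly_small:
  assumes f: "f \<in> AE_class"
  obtains m L where "m > 0" "L > 0" "\<And>c. \<exists>z\<in>ball c L. m \<le> norm (spherical f z)"
proof -
  obtain z w where zw: "ext_val f z \<noteq> ext_val f w" using f by (auto simp: AE_class_def)
  have "\<exists>u. ext_val f u \<noteq> Some 0"
  proof (rule ccontr)
    assume "\<not> ?thesis"
    with zw show False by simp
  qed
  then obtain u where u: "ext_val f u \<noteq> Some 0" ..
  have pos: "norm (spherical f u) > 0"
  proof (cases "u \<in> poles f")
    case False
    have "1 + (cmod (f u))\<^sup>2 > 0" by (rule one_plus_square_pos)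
    moreover have "cmod (f u) > 0" using False u by (simp add: ext_val_def)
    ultimately show ?thesis
      unfolding spherical_nonpole[OF False] norm_sphere_pt_Some by simp
  qed (simp add: spherical_pole del: zero_less_norm_iff)
  obtain L where L: "L > 0" "\<And>c. \<exists>\<tau>\<in>ball c L. almost_period f (norm (spherical f u) / 2) \<tau>"
    using AE_class_almost_periods[OF f, of "norm (spherical f u) / 2"] pos by auto
  show ?thesis
  proof (rule that[of "norm (spherical f u) / 2" L])
    fix c
    obtain \<tau> where \<tau>: "\<tau> \<in> ball (c - u) L" "almost_period f (norm (spherical f u) / 2) \<tau>"
      using L(2) by blast
    have "dist (spherical f (u + \<tau>)) (spherical f u) < norm (spherical f u) / 2"
      using \<tau>(2) by (simp add: almost_period_spherical)
    then have "norm (spherical f u) / 2 \<le> norm (spherical f (u + \<tau>))"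
      using norm_triangle_ineq2[of "spherical f u" "spherical f (u + \<tau>)"]
      by (simp add: dist_norm norm_minus_commute)
    moreover have "u + \<tau> \<in> ball c L" using \<tau>(1) by (simp add: dist_norm algebra_simps)
    ultimately show "\<exists>z\<in>ball c L. norm (spherical f u) / 2 \<le> norm (spherical f z)" by blast
  qed (use pos L in auto)
qed

section \<open>Propagation of smallness\<close>

text \<open>A counterexample sequence has, by Montel's theorem, a limit with a zero on every small circle
  around 0, hence vanishing identically.\<close>
lemma small_on_circles_imp_small:
  fixes r s e :: real
  assumes s: "0 < s" "s \<le> r" and e: "e > 0"
  shows "\<exists>d>0. \<forall>h. h holomorphic_on ball 0 r \<longrightarrow> (\<forall>z\<in>ball 0 r. cmod (h z) \<le> 1) \<longrightarrow>
     (\<forall>\<rho>\<in>{0<..<s}. \<exists>z\<in>sphere 0 \<rho>. cmod (h z) < d) \<longrightarrow> (\<forall>z\<in>cball 0 (r/2). cmod (h z) < e)"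
proof (rule ccontr)
  assume "\<not> ?thesis"
  then have "\<exists>h z. h holomorphic_on ball 0 r \<and> (\<forall>z\<in>ball 0 r. cmod (h z) \<le> 1) \<and>
     (\<forall>\<rho>\<in>{0<..<s}. \<exists>z\<in>sphere 0 \<rho>. cmod (h z) < d) \<and> z \<in> cball 0 (r/2) \<and> e \<le> cmod (h z)"
    if "d > 0" for d
    using that by (simp only: not_ex not_all not_imp de_Morgan_conj) (meson not_less)
  then have "\<exists>h z. h holomorphic_on ball 0 r \<and> (\<forall>z\<in>ball 0 r. cmod (h z) \<le> 1) \<and>
     (\<forall>\<rho>\<in>{0<..<s}. \<exists>z\<in>sphere 0 \<rho>. cmod (h z) < 1 / Suc n) \<and> z \<in> cball 0 (r/2) \<and> e \<le> cmod (h z)"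
    for n by (simp only: zero_less_divide_1_iff of_nat_0_less_iff zero_less_Suc)
  then obtain h z where h: "\<And>n. h n holomorphic_on ball 0 r"
    and h1: "\<And>n z. z \<in> ball 0 r \<Longrightarrow> cmod (h n z) \<le> 1"
    and small: "\<And>n \<rho>. \<rho> \<in> {0<..<s} \<Longrightarrow> \<exists>z\<in>sphere 0 \<rho>. cmod (h n z) < 1 / Suc n"
    and z: "\<And>n. z n \<in> cball 0 (r/2)" "\<And>n. e \<le> cmod (h n (z n))"
    by metis
  obtain g k where g: "g holomorphic_on ball 0 r" and k: "strict_mono (k :: nat \<Rightarrow> nat)"
    and lim: "\<And>K. compact K \<Longrightarrow> K \<subseteq> ball 0 r \<Longrightarrow> uniform_limit K (h \<circ> k) g sequentially"
  proof (rule Montel[of "ball 0 r" "range h" h])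
    show "\<exists>B. \<forall>h\<in>range h. \<forall>z\<in>K. cmod (h z) \<le> B" if "K \<subseteq> ball 0 r" for K
      using h1 that by (intro exI[of _ 1]) blast
  qed (use h in auto)
  \<comment> \<open>Otherwise \<open>g\<close> has a positive minimum \<open>m\<close> of its
    modulus on the circle. Late members of the subsequence are within \<open>m/2\<close> of
    \<open>g\<close> there, yet have a point of modulus below \<open>m/2\<close>.\<close>
  have zero: "\<exists>w\<in>sphere 0 \<rho>. g w = 0" if \<rho>: "\<rho> \<in> {0<..<s}" for \<rho>
  proof (rule ccontr)
    assume nz: "\<not> ?thesis"
    have sub: "sphere 0 \<rho> \<subseteq> ball (0::complex) r" using \<rho> s by auto
    have "continuous_on (sphere 0 \<rho>) g"
      by (rule continuous_on_subset[OF holomorphic_on_imp_continuous_on[OF g] sub])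
    then have "continuous_on (sphere 0 \<rho>) (\<lambda>w. cmod (g w))" by (intro continuous_intros)
    moreover have "sphere (0::complex) \<rho> \<noteq> {}" using \<rho> by simp
    ultimately obtain x where x: "x \<in> sphere 0 \<rho>" "\<forall>y\<in>sphere 0 \<rho>. cmod (g x) \<le> cmod (g y)"
      using continuous_attains_inf[OF compact_sphere] by blast
    define m where "m = cmod (g x)"
    have m: "m > 0" using nz x(1) by (auto simp: m_def)
    have "\<forall>\<^sub>F n in sequentially. \<forall>w\<in>sphere 0 \<rho>. dist ((h \<circ> k) n w) (g w) < m / 2"
      using uniform_limitD[OF lim[OF compact_sphere sub], of "m/2"] m by simp
    moreover have "\<forall>\<^sub>F n in sequentially. 1 / real (Suc n) < m / 2"
      using m by (intro order_tendstoD(2)[OF LIMSEQ_Suc[OF lim_1_over_n]]) simp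
    ultimately have "\<forall>\<^sub>F n in sequentially. False"
    proof eventually_elim
      fix n assume n: "\<forall>w\<in>sphere 0 \<rho>. dist ((h \<circ> k) n w) (g w) < m / 2" "1 / real (Suc n) < m / 2"
      obtain w where w: "w \<in> sphere 0 \<rho>" "cmod (h (k n) w) < 1 / Suc (k n)"
        using small[OF \<rho>] by blast
      have "1 / real (Suc (k n)) \<le> 1 / real (Suc n)"
        using seq_suble[OF k, of n] by (intro divide_left_mono) auto
      then have "cmod (h (k n) w) < m / 2" using w(2) n(2) by linarith
      moreover have "cmod (h (k n) w - g w) < m / 2" using n(1) w(1) by (simp add: dist_norm)
      moreover have "m \<le> cmod (g w)" using x(2) w(1) by (simp add: m_def)
      moreover have "cmod (g w) \<le> cmod (h (k n) w) + cmod (h (k n) w - g w)"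
        by (metis norm_minus_commute norm_triangle_sub)
      ultimately show False by linarith
    qed
    then show False by simp
  qed
  define U where "U = {w\<in>ball 0 r. g w = 0}"
  have "0 islimpt U"
    unfolding islimpt_approachable
  proof (intro allI impI)
    fix \<epsilon> :: real assume "\<epsilon> > 0"
    then have \<rho>: "min \<epsilon> s / 2 \<in> {0<..<s}" "min \<epsilon> s / 2 < \<epsilon>" using s by auto
    obtain w where w: "w \<in> sphere 0 (min \<epsilon> s / 2)" "g w = 0" using zero[OF \<rho>(1)] by blast
    then have nw: "norm w = min \<epsilon> s / 2" by simp
    then have "norm w > 0" "norm w < r" using \<rho>(1) s by auto
    then show "\<exists>x'\<in>U. x' \<noteq> 0 \<and> dist x' 0 < \<epsilon>"
      using w(2) nw \<rho>(2) by (intro bexI[of _ w]) (auto simp: U_def)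
  qed
  then have g0: "g w = 0" if "w \<in> ball 0 r" for w
    using that s by (intro analytic_continuation[OF g, of U 0 w]) (auto simp: U_def)
  have sub: "cball 0 (r/2) \<subseteq> ball (0::complex) r" using s by auto
  \<comment> \<open>The points \<open>z (k n)\<close> vary with \<open>n\<close>, so uniform
    convergence to \<open>g = 0\<close> is what contradicts the lower bound
    \<open>e\<close>.\<close>
  have "\<forall>\<^sub>F n in sequentially. \<forall>w\<in>cball 0 (r/2). dist ((h \<circ> k) n w) (g w) < e"
    using uniform_limitD[OF lim[OF compact_cball sub] e] .
  then have "\<forall>\<^sub>F n in sequentially. False"
  proof eventually_elim
    fix n assume "\<forall>w\<in>cball 0 (r/2). dist ((h \<circ> k) n w) (g w) < e"
    then have "dist ((h \<circ> k) n (z (k n))) (g (z (k n))) < e" using z(1) by blast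
    moreover have "g (z (k n)) = 0" using z(1) sub by (intro g0) blast
    ultimately show False using z(2)[of "k n"] by simp
  qed
  then show False by simp
qed

text \<open>The form of smallness that propagates. Smallness at the centre alone would not do, since
  it occurs at every zero of \<open>f\<close>.\<close>

definition small_on_circles :: "(complex \<Rightarrow> complex) \<Rightarrow> real \<Rightarrow> complex \<Rightarrow> real \<Rightarrow> bool" where
  "small_on_circles f s c d \<longleftrightarrow> (\<forall>\<rho>\<in>{0<..<s}. \<exists>z\<in>sphere c \<rho>. norm (spherical f z) < d)"

text \<open>Translating \<open>c\<close> to the origin reduces this to
  \<open>small_on_circles_imp_small\<close>, whose threshold does not depend on the function; hence
  \<open>d\<close> is uniform in \<open>c\<close>. The oscillation bound excludes poles in the disc
  of radius \<open>r\<close> and bounds \<open>f\<close> by 1 there.\<close>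

lemma small_on_circles_spreads:
  assumes f: "meromorphic_C f" and r: "r > 0"
    and osc: "\<And>z w. dist z w < 2 * r \<Longrightarrow> dist (spherical f z) (spherical f w) < 1/4"
    and s: "0 < s" "s \<le> r" and e: "e > 0"
  shows "\<exists>d>0. \<forall>c. small_on_circles f s c d \<longrightarrow> (\<forall>z\<in>cball c (r/2). norm (spherical f z) < e)"
proof -
  obtain d where d: "d > 0" "\<And>h. h holomorphic_on ball 0 r \<Longrightarrow> (\<forall>z\<in>ball 0 r. cmod (h z) \<le> 1) \<Longrightarrow>
     (\<forall>\<rho>\<in>{0<..<s}. \<exists>z\<in>sphere 0 \<rho>. cmod (h z) < d) \<Longrightarrow> (\<forall>z\<in>cball 0 (r/2). cmod (h z) < e)"
    using small_on_circles_imp_small[OF s e] by blast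
  show ?thesis
  \<comment> \<open>The value 1/4 plus the oscillation 1/4 stays within 1/2, where
    \<open>norm_sphere_pt_le_half\<close> applies; \<open>d/2\<close> absorbs its factor 2.\<close>
  proof (intro exI[of _ "min (d/2) (1/4)"] conjI allI impI ballI)
    show "0 < min (d/2) (1/4)" using d(1) by simp
    fix c z assume small: "small_on_circles f s c (min (d/2) (1/4))" and z: "z \<in> cball c (r/2)"
    have "s/2 \<in> {0<..<s}" using s by simp
    then obtain z0 where z0: "z0 \<in> sphere c (s/2)" "norm (spherical f z0) < min (d/2) (1/4)"
      using small unfolding small_on_circles_def by blast
    have half: "norm (spherical f w) < 1/2" if "w \<in> ball c r" for w
    proof -
      have "dist w z0 < 2 * r"
        using dist_triangle[of w z0 c] that z0(1) s by (simp add: dist_commute)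
      then have "dist (spherical f w) (spherical f z0) < 1/4" by (rule osc)
      then show ?thesis
        using z0(2) norm_triangle_sub[of "spherical f w" "spherical f z0"] by (simp add: dist_norm)
    qed
    then have nonpole: "w \<notin> poles f" if "w \<in> ball c r" for w
      using that nonpole_if_norm_spherical_less[of f w] by fastforce
    have le: "cmod (f w) \<le> 1" "cmod (f w) \<le> 2 * norm (spherical f w)" if "w \<in> ball c r" for w
      using norm_sphere_pt_le_half[of "f w"] half[OF that] spherical_nonpole[OF nonpole[OF that]] by auto
    define h where "h = (\<lambda>u. f (c + u))"
    have *: "c + u \<in> ball c r" if "u \<in> ball 0 r" for u using that by (simp add: dist_norm)
    have "f holomorphic_on ball c r"
      using f nonpole by (auto simp: meromorphic_C_def intro: holomorphic_on_subset)
    moreover have "(\<lambda>u. c + u) ` ball 0 r \<subseteq> ball c r" using * by blast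
    ultimately have "h holomorphic_on ball 0 r"
      unfolding h_def by (intro holomorphic_on_compose_gen[of "\<lambda>u. c + u" _ f, unfolded o_def]) (auto intro!: holomorphic_intros)
    moreover have "\<forall>z\<in>ball 0 r. cmod (h z) \<le> 1" using le(1) * by (simp add: h_def)
    moreover have "\<forall>\<rho>\<in>{0<..<s}. \<exists>z\<in>sphere 0 \<rho>. cmod (h z) < d"
    proof
      fix \<rho> assume \<rho>: "\<rho> \<in> {0<..<s}"
      obtain w where w: "w \<in> sphere c \<rho>" "norm (spherical f w) < min (d/2) (1/4)"
        using small \<rho> unfolding small_on_circles_def by blast
      have "w \<in> ball c r" using w(1) \<rho> s by simp
      then have "cmod (f w) < d" using le(2)[of w] w(2) by simp
      moreover have "w - c \<in> sphere 0 \<rho>" using w(1) by (simp add: dist_norm norm_minus_commute)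
      ultimately show "\<exists>z\<in>sphere 0 \<rho>. cmod (h z) < d"
        by (intro bexI[of _ "w - c"]) (simp_all add: h_def)
    qed
    ultimately have "\<forall>z\<in>cball 0 (r/2). cmod (h z) < e" by (rule d(2))
    moreover have "z - c \<in> cball 0 (r/2)" using z by (simp add: dist_norm norm_minus_commute)
    ultimately have "cmod (h (z - c)) < e" by blast
    then have "cmod (f z) < e" by (simp add: h_def)
    moreover have "z \<in> ball c r" using z r by simp
    ultimately show "norm (spherical f z) < e"
      using norm_sphere_pt_le[of "f z"] spherical_nonpole[OF nonpole] by fastforce
  qed
qed

text \<open>A chain of \<open>N\<close> steps of length at most \<open>r/4\<close>. As
  \<open>s \<le> r/4\<close>, all circles of radius below \<open>s\<close> about the next centre lie
  in the disc of radius \<open>r/2\<close> about the previous one, where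
  \<open>small_on_circles_spreads\<close> gives smallness. The threshold shrinks with each step, so
  \<open>e\<close> is arbitrary in the induction.\<close>

lemma small_on_circles_spreads_far:
  assumes f: "meromorphic_C f" and r: "r > 0"
    and osc: "\<And>z w. dist z w < 2 * r \<Longrightarrow> dist (spherical f z) (spherical f w) < 1/4"
    and s: "0 < s" "s \<le> r/4" and e: "e > 0"
  shows "\<exists>d>0. \<forall>c c'. small_on_circles f s c d \<longrightarrow> dist c c' \<le> real N * (r/4) \<longrightarrow> small_on_circles f s c' e"
  using e
proof (induction N arbitrary: e)
  case 0
  then show ?case by (intro exI[of _ e]) auto
next
  case (Suc N)
  have s': "s \<le> r" using s r by linarith
  obtain e1 where e1: "e1 > 0"
    "\<And>c. small_on_circles f s c e1 \<Longrightarrow> (\<forall>z\<in>cball c (r/2). norm (spherical f z) < e)"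
    using small_on_circles_spreads[OF f r osc s(1) s' Suc.prems] by blast
  obtain d where d: "d > 0"
    "\<And>c c'. small_on_circles f s c d \<Longrightarrow> dist c c' \<le> real N * (r/4) \<Longrightarrow> small_on_circles f s c' e1"
    using Suc.IH[OF e1(1)] by blast
  show ?case
  proof (intro exI[of _ d] conjI allI impI d(1))
    fix c c' assume small: "small_on_circles f s c d" and dist: "dist c c' \<le> real (Suc N) * (r/4)"
    \<comment> \<open>The point \<open>b\<close> splits the segment from \<open>c\<close> to
      \<open>c'\<close> in the ratio \<open>N\<close> to 1: the induction hypothesis reaches
      \<open>b\<close>, one more step reaches \<open>c'\<close>.\<close>
    define t where "t = real N / real (Suc N)"
    define b where "b = c + of_real t * (c' - c)"
    have t: "0 \<le> t" "1 - t = 1 / real (Suc N)" by (auto simp: t_def field_simps)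
    have "dist c b = t * dist c c'"
      using t(1) by (simp add: b_def dist_norm norm_mult norm_minus_commute)
    also have "\<dots> \<le> t * (real (Suc N) * (r/4))" using dist t(1) by (rule mult_left_mono)
    also have "\<dots> = real N * (r/4)" by (simp add: t_def)
    finally have "small_on_circles f s b e1" by (rule d(2)[OF small])
    then have sm: "\<forall>z\<in>cball b (r/2). norm (spherical f z) < e" by (rule e1(2))
    have "c' - b = of_real (1 - t) * (c' - c)" by (simp add: b_def algebra_simps)
    then have "dist c' b = (1 / real (Suc N)) * dist c c'"
      by (simp only: dist_norm norm_mult norm_of_real t(2)) (simp add: norm_minus_commute)
    also have "\<dots> \<le> (1 / real (Suc N)) * (real (Suc N) * (r/4))" using dist by (rule mult_left_mono) simp
    finally have b: "dist b c' \<le> r/4" by (simp add: dist_commute)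
    show "small_on_circles f s c' e"
      unfolding small_on_circles_def
    proof
      fix \<rho> assume \<rho>: "\<rho> \<in> {0<..<s}"
      have c\<rho>: "dist c' (c' + of_real \<rho>) = \<rho>" using \<rho> by (simp add: dist_norm)
      have "dist b (c' + of_real \<rho>) \<le> r/2"
        using dist_triangle[of b "c' + of_real \<rho>" c'] b c\<rho> \<rho> s by simp
      then show "\<exists>z\<in>sphere c' \<rho>. norm (spherical f z) < e"
        using sm c\<rho> by (intro bexI[of _ "c' + of_real \<rho>"]) (simp_all only: mem_cball mem_sphere)
    qed
  qed
qed

text \<open>If \<open>d\<close> failed at some \<open>c\<close>, smallness would spread to all
  centres within distance \<open>L\<close>, among them a point where the norm is at least
  \<open>m\<close>. The constants are chosen backwards: \<open>d1\<close> from \<open>m\<close>,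
  then \<open>d\<close> from \<open>d1\<close> and the number of steps.\<close>

lemma AE_class_large_on_small_circles:
  assumes f: "f \<in> AE_class" and e: "e > 0"
  shows "\<exists>d>0. \<forall>c. \<exists>\<rho>\<in>{0<..<e}. \<forall>z\<in>sphere c \<rho>. d \<le> norm (spherical f z)"
proof -
  note mero = AE_class_meromorphic[OF f]
  obtain r0 where r0: "r0 > 0" "\<And>z w. dist w z < r0 \<Longrightarrow> dist (spherical f w) (spherical f z) < 1/4"
    using AE_class_uniformly_continuous[OF f] unfolding uniformly_continuous_on_def
    by (elim allE[of _ "1/4"]) auto
  define r where "r = r0 / 2"
  have r: "r > 0" "\<And>z w. dist z w < 2 * r \<Longrightarrow> dist (spherical f z) (spherical f w) < 1/4"
    using r0 by (auto simp: r_def)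
  \<comment> \<open>The bound \<open>e\<close> places these circles among those in the claim; the
    bound \<open>r/4\<close> is what chaining requires.\<close>
  define s where "s = min e (r/4)"
  have s: "0 < s" "s \<le> r/4" "s \<le> r" using e r by (auto simp: s_def)
  obtain m L where m: "m > 0" "L > 0" "\<And>c. \<exists>z\<in>ball c L. m \<le> norm (spherical f z)"
    using AE_class_not_uniformly_small[OF f] by blast
  obtain d1 where d1: "d1 > 0"
    "\<And>c. small_on_circles f s c d1 \<Longrightarrow> (\<forall>z\<in>cball c (r/2). norm (spherical f z) < m)"
    using small_on_circles_spreads[OF mero r s(1,3) m(1)] by blast
  obtain N :: nat where "L / (r/4) \<le> real N" using real_arch_simple by blast
  then have N: "L \<le> real N * (r/4)" using r(1) by (simp add: field_simps)
  obtain d where d: "d > 0"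
    "\<And>c c'. small_on_circles f s c d \<Longrightarrow> dist c c' \<le> real N * (r/4) \<Longrightarrow> small_on_circles f s c' d1"
    using small_on_circles_spreads_far[OF mero r s(1,2) d1(1)] by blast
  show ?thesis
  proof (intro exI[of _ d] conjI allI d(1))
    fix c
    show "\<exists>\<rho>\<in>{0<..<e}. \<forall>z\<in>sphere c \<rho>. d \<le> norm (spherical f z)"
    proof (rule ccontr)
      assume *: "\<not> ?thesis"
      have small: "small_on_circles f s c d"
        unfolding small_on_circles_def
      proof
        fix \<rho> assume "\<rho> \<in> {0<..<s}"
        then have "\<rho> \<in> {0<..<e}" by (simp add: s_def)
        with * show "\<exists>z\<in>sphere c \<rho>. norm (spherical f z) < d" by (meson not_le)
      qed
      obtain z where z: "z \<in> ball c L" "m \<le> norm (spherical f z)" using m(3) by blast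
      have "dist c z \<le> real N * (r/4)" using z(1) N by simp
      then have "small_on_circles f s z d1" by (rule d(2)[OF small])
      then have "norm (spherical f z) < m" by (rule d1(2)[THEN bspec]) (use r in simp)
      with z(2) show False by simp
    qed
  qed
qed

section \<open>Matching the zeros\<close>

text \<open>The predicates under the two definite descriptions coincide: a local factorization can
  be translated, and translating by \<open>- \<tau>\<close> gives the converse.\<close>

lemma zero_mult_translate: "zero_mult (\<lambda>w. f (w + \<tau>)) z = zero_mult f (z + \<tau>)"
proof -
  define P where "P = (\<lambda>f z n. \<exists>r>0. \<exists>g. g holomorphic_on ball z r \<and> g z \<noteq> 0 \<and>
                        (\<forall>w\<in>ball z r. f w = (w - z) ^ n * g w))"
  have *: "P (\<lambda>w. f (w + \<tau>)) z n" if P: "P f (z + \<tau>) n" for f z n and \<tau> :: complex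
  proof -
    obtain r g where r: "r > 0" "g holomorphic_on ball (z + \<tau>) r" "g (z + \<tau>) \<noteq> 0"
      "\<And>w. w \<in> ball (z + \<tau>) r \<Longrightarrow> f w = (w - (z + \<tau>)) ^ n * g w"
      using P unfolding P_def by blast
    have *: "w + \<tau> \<in> ball (z + \<tau>) r" if "w \<in> ball z r" for w using that by (simp add: dist_norm)
    then have "(\<lambda>w. w + \<tau>) ` ball z r \<subseteq> ball (z + \<tau>) r" by blast
    then have "(\<lambda>w. g (w + \<tau>)) holomorphic_on ball z r"
      by (intro holomorphic_on_compose_gen[OF _ r(2), of "\<lambda>w. w + \<tau>", unfolded o_def])
        (auto intro!: holomorphic_intros)
    moreover have "f (w + \<tau>) = (w - z) ^ n * g (w + \<tau>)" if "w \<in> ball z r" for w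
      using r(4)[OF *[OF that]] by simp
    ultimately show ?thesis
      unfolding P_def using r(1,3) by (intro exI[of _ r] conjI exI[of _ "\<lambda>w. g (w + \<tau>)"] ballI)
  qed
  have "P (\<lambda>w. f (w + \<tau>)) z n = P f (z + \<tau>) n" for n
  proof
    assume "P (\<lambda>w. f (w + \<tau>)) z n"
    then show "P f (z + \<tau>) n" using *[of "\<lambda>w. f (w + \<tau>)" "z + \<tau>" "- \<tau>" n] by simp
  qed (rule *)
  then have "P (\<lambda>w. f (w + \<tau>)) z = P f (z + \<tau>)" by blast
  then show ?thesis unfolding zero_mult_def P_def by (rule arg_cong[where f = The])
qed

text \<open>Translation matches the copies of zeros of the shifted function in \<open>K\<close> with
  the entries of \<open>zero_list f\<close> over the translate of \<open>K\<close>. The hypothesis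
  on poles ensures that a value 0 there is a genuine zero. The instance with shift 0 counts the
  zeros in \<open>K\<close> itself.\<close>

lemma
  assumes K: "\<And>z. z \<in> K \<Longrightarrow> z + \<tau> \<notin> poles f" and fin: "finite {z\<in>K. f (z + \<tau>) = 0}"
  shows finite_zero_list_translate: "finite {a\<in>zero_list f. fst a - \<tau> \<in> K}"
    and card_zero_list_translate:
      "card {a\<in>zero_list f. fst a - \<tau> \<in> K} = zero_count (\<lambda>z. f (z + \<tau>)) K"
proof -
  define g where "g = (\<lambda>z. f (z + \<tau>))"
  define S where "S = (SIGMA z:{z\<in>K. g z = 0}. {..<zero_mult g z})"
  have fin': "finite {z\<in>K. g z = 0}" using fin by (simp add: g_def)
  have "bij_betw (\<lambda>(z, k). (z + \<tau>, k)) S {a\<in>zero_list f. fst a - \<tau> \<in> K}"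
  proof (rule bij_betw_byWitness[where f' = "\<lambda>(z, k). (z - \<tau>, k)"])
    show "(\<lambda>(z, k). (z + \<tau>, k)) ` S \<subseteq> {a \<in> zero_list f. fst a - \<tau> \<in> K}"
      using K by (auto simp: S_def zero_list_def g_def zero_mult_translate)
    show "(\<lambda>(z, k). (z - \<tau>, k)) ` {a \<in> zero_list f. fst a - \<tau> \<in> K} \<subseteq> S"
      by (auto simp: S_def zero_list_def g_def zero_mult_translate)
  qed auto
  moreover have "finite S" unfolding S_def using fin' by (intro finite_SigmaI) auto
  moreover have "card S = zero_count g K"
    unfolding S_def zero_count_def using fin' by (subst card_SigmaI) auto
  ultimately show "finite {a\<in>zero_list f. fst a - \<tau> \<in> K}"
    "card {a\<in>zero_list f. fst a - \<tau> \<in> K} = zero_count (\<lambda>z. f (z + \<tau>)) K"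
    using bij_betw_finite bij_betw_same_card unfolding g_def by (blast, fastforce)
qed

text \<open>On the closed unit disc each factor of the denominator in \<open>rho_S\<close> is at
  most the square root of 2.\<close>

lemma cmod_diff_le_dist_sphere_pt:
  assumes "cmod a \<le> 1" "cmod b \<le> 1"
  shows "cmod (a - b) \<le> 2 * dist (sphere_pt (Some a)) (sphere_pt (Some b))"
proof -
  define A B where "A = sqrt (1 + (cmod a)\<^sup>2)" and "B = sqrt (1 + (cmod b)\<^sup>2)"
  have pos: "A > 0" "B > 0" by (simp_all add: A_def B_def one_plus_square_pos)
  have "A \<le> sqrt 2" "B \<le> sqrt 2"
    unfolding A_def B_def using assms by (auto intro!: real_sqrt_le_mono simp: abs_square_le_1)
  then have "A * B \<le> sqrt 2 * sqrt 2" using pos by (intro mult_mono) auto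
  then have "A * B \<le> 2" by simp
  then have "cmod (a - b) * (A * B) \<le> cmod (a - b) * 2" by (rule mult_left_mono) simp
  then have "cmod (a - b) \<le> 2 * (cmod (a - b) / (A * B))"
    using pos by (simp add: pos_le_divide_eq mult.commute)
  then show ?thesis by (simp add: dist_sphere_pt A_def B_def)
qed

text \<open>On the frontier the translate differs from \<open>f\<close> by less than
  \<open>2 * (d/2) = d\<close>, while \<open>d\<close> is at most the modulus of \<open>f\<close>,
  which is the inequality for Rouche's theorem. The bound \<open>d \<le> 1/4\<close> keeps both
  functions at spherical norm at most 1/2 on the closure, hence away from poles and of modulus at
  most 1.\<close>

lemma zero_count_translate_eq:
  assumes f: "meromorphic_C f" and d: "0 < d" "d \<le> 1/4" and \<tau>: "almost_period f (d/2) \<tau>"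
    and K: "open K" "connected K" "bounded K"
    and cl: "\<And>z. z \<in> closure K \<Longrightarrow> norm (spherical f z) \<le> d"
    and fr: "\<And>z. z \<in> frontier K \<Longrightarrow> d \<le> norm (spherical f z)"
  shows "\<exists>\<sigma>. bij_betw \<sigma> {a\<in>zero_list f. fst a \<in> K} {a\<in>zero_list f. fst a - \<tau> \<in> K}"
proof -
  define g where "g = (\<lambda>z. f (z + \<tau>))"
  have dist: "dist (spherical f (z + \<tau>)) (spherical f z) < d/2" for z
    using \<tau> by (simp add: almost_period_spherical)
  have le: "norm (spherical f z) \<le> 1/2" "norm (spherical f (z + \<tau>)) \<le> 1/2" if "z \<in> closure K" for z
    using cl[OF that] dist[of z] d norm_triangle_sub[of "spherical f (z + \<tau>)" "spherical f z"]
    by (auto simp: dist_norm)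
  have np: "z \<notin> poles f" "z + \<tau> \<notin> poles f" if "z \<in> closure K" for z
    using le[OF that] by (auto intro!: nonpole_if_norm_spherical_less)
  have le1: "cmod (f z) \<le> 1" "cmod (g z) \<le> 1" if "z \<in> closure K" for z
    using le[OF that] np[OF that] norm_sphere_pt_le_half(1) by (auto simp: g_def spherical_nonpole)
  define V where "V = - poles f \<inter> (\<lambda>z. z + \<tau>) -` (- poles f)"
  have holf: "f holomorphic_on - poles f"
    using f by (simp add: meromorphic_C_def Compl_eq_Diff_UNIV)
  have fV: "f holomorphic_on V"
    by (rule holomorphic_on_subset[OF holf]) (auto simp: V_def)
  have "(\<lambda>z. z + \<tau>) ` V \<subseteq> - poles f" by (auto simp: V_def)
  then have gV: "g holomorphic_on V"
    unfolding g_def by (intro holomorphic_on_compose_gen[OF _ holf, of "\<lambda>w. w + \<tau>", unfolded o_def])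
      (auto intro!: holomorphic_intros)
  have V: "open V" "closure K \<subseteq> V"
    using open_nonpoles[OF f] np by (auto simp: V_def intro!: open_Int open_vimage continuous_intros)
  have frcl: "z \<in> closure K" if "z \<in> frontier K" for z using that by (simp add: frontier_def)
  have less: "cmod (g z - f z) < cmod (f z)" if "z \<in> frontier K" for z
  proof -
    note z = frcl[OF that]
    have "cmod (g z - f z) \<le> 2 * dist (spherical f (z + \<tau>)) (spherical f z)"
      using cmod_diff_le_dist_sphere_pt[OF le1(2)[OF z] le1(1)[OF z]] np[OF z]
      by (simp add: spherical_nonpole g_def)
    also have "\<dots> < d" using dist[of z] by simp
    also have "d \<le> norm (spherical f z)" by (rule fr[OF that])
    also have "\<dots> \<le> cmod (f z)" using norm_sphere_pt_le np[OF z] by (simp add: spherical_nonpole)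
    finally show ?thesis .
  qed
  have nz: "f z \<noteq> 0" "g z \<noteq> 0" if "z \<in> frontier K" for z using less[OF that] by auto
  have fin: "finite {z\<in>K. f z = 0}" "finite {z\<in>K. g z = 0}"
    using finite_zeros_of_frontier_nonzero[OF fV V K nz(1)] finite_zeros_of_frontier_nonzero[OF gV V K nz(2)]
      closure_subset[of K] by (blast intro: finite_subset[rotated])+
  have KK: "z \<notin> poles f" "z + \<tau> \<notin> poles f" if "z \<in> K" for z
    using np closure_subset[of K] that by blast+
  have "zero_count f K = zero_count g K"
    by (rule Rouche_bounded_open[OF fV gV V K less])
  then have "card {a\<in>zero_list f. fst a \<in> K} = card {a\<in>zero_list f. fst a - \<tau> \<in> K}"
    using card_zero_list_translate[of K \<tau> f] card_zero_list_translate[of K 0 f] KK fin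
    by (simp add: g_def)
  moreover have "finite {a\<in>zero_list f. fst a \<in> K}" "finite {a\<in>zero_list f. fst a - \<tau> \<in> K}"
    using finite_zero_list_translate[of K \<tau> f] finite_zero_list_translate[of K 0 f] KK fin
    by (simp_all add: g_def)
  ultimately show ?thesis using bij_betw_iff_card by blast
qed

text \<open>This is the zero half of \<open>div_almost_period\<close>; the pole half comes from
  applying it to the reciprocal. Since every almost period with error \<open>d\<close> works, one
  \<open>\<tau>\<close> can serve both halves.\<close>

lemma AE_class_zero_list_almost_period:
  assumes f: "f \<in> AE_class" and e: "e > 0"
  obtains d where "d > 0" "\<And>\<tau>. almost_period f d \<tau> \<Longrightarrow>
    \<exists>\<sigma>. bij_betw \<sigma> (zero_list f) (zero_list f) \<and> (\<forall>a\<in>zero_list f. cmod (fst a + \<tau> - fst (\<sigma> a)) < e)"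
proof -
  note mero = AE_class_meromorphic[OF f]
  obtain d0 where d0: "d0 > 0" "\<And>c. \<exists>\<rho>\<in>{0<..<e}. \<forall>z\<in>sphere c \<rho>. d0 \<le> norm (spherical f z)"
    using AE_class_large_on_small_circles[OF f e] by blast
  define d where "d = min d0 (1/4)"
  have d: "d > 0" "d \<le> 1/4" "d \<le> d0" using d0(1) by (auto simp: d_def)
  define U where "U = {z. norm (spherical f z) < d}"
  have contn: "continuous_on UNIV (\<lambda>z. norm (spherical f z))"
    by (intro continuous_intros continuous_spherical mero)
  have U: "open U" unfolding U_def by (intro open_Collect_less contn continuous_intros)
  define C where "C = connected_component_set U"
  have CU: "C c \<subseteq> U" for c unfolding C_def by (rule connected_component_subset)
  have Cc: "c \<in> C c" if "c \<in> U" for c using that by (simp add: C_def)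
  \<comment> \<open>Some circle about \<open>z\<close> of radius below \<open>e\<close> misses
    \<open>U\<close>, so the connected set \<open>C c\<close>, containing the centre, cannot leave
    its disc.\<close>
  have diam: "dist z w < e" if "z \<in> C c" "w \<in> C c" for z w c
  proof -
    obtain \<rho> where \<rho>: "\<rho> \<in> {0<..<e}" "\<forall>u\<in>sphere z \<rho>. d0 \<le> norm (spherical f u)"
      using d0(2) by blast
    have "C c \<inter> sphere z \<rho> = {}" using \<rho>(2) CU[of c] d(3) by (force simp: U_def)
    moreover have "connected (C c)" by (simp add: C_def)
    moreover have "C c \<inter> ball z \<rho> \<noteq> {}" using that(1) \<rho>(1) by (auto simp: disjoint_iff)
    ultimately have "C c - ball z \<rho> = {}"
      using connected_Int_frontier[of "C c" "ball z \<rho>"] \<rho>(1) by (auto simp del: Diff_eq_empty_iff)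
    then have "w \<in> ball z \<rho>" using that(2) by blast
    then show ?thesis using \<rho>(1) by simp
  qed
  show ?thesis
  proof (rule that[of "d/2"])
    show "d/2 > 0" using d(1) by simp
    fix \<tau> assume \<tau>: "almost_period f (d/2) \<tau>"
    define A B where "A = (\<lambda>K. {a\<in>zero_list f. fst a \<in> K})"
      and "B = (\<lambda>K. {a\<in>zero_list f. fst a - \<tau> \<in> K})"
    have ex: "\<exists>\<sigma>. bij_betw \<sigma> (A (C c)) (B (C c))" for c
      unfolding A_def B_def
    proof (rule zero_count_translate_eq[OF mero d(1,2) \<tau>])
      show "open (C c)" "connected (C c)" by (auto simp: C_def open_connected_component U)
      show "bounded (C c)"
      proof (cases "C c = {}")
        case False
        then obtain z where "z \<in> C c" by blast
        then have "C c \<subseteq> ball z e" using diam by auto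
        then show ?thesis using bounded_subset bounded_ball by blast
      qed simp
      have "closed {z. norm (spherical f z) \<le> d}"
        by (intro closed_Collect_le contn continuous_intros)
      moreover have "C c \<subseteq> {z. norm (spherical f z) \<le> d}" using CU[of c] by (auto simp: U_def)
      ultimately have "closure (C c) \<subseteq> {z. norm (spherical f z) \<le> d}" by (rule closure_minimal[rotated])
      then show "norm (spherical f z) \<le> d" if "z \<in> closure (C c)" for z using that by blast
      show "d \<le> norm (spherical f z)" if "z \<in> frontier (C c)" for z
      proof -
        have "z \<in> frontier U"
          using frontier_of_connected_component_subset that unfolding C_def by blast
        then have "z \<notin> U" using U by (simp add: frontier_def interior_open)
        then show ?thesis by (simp add: U_def)
      qed
    qed
    \<comment> \<open>The choice depends on the component as a set, not on a point naming it, so all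
      zeros of one component use the same bijection.\<close>
    define S where "S = (\<lambda>K. SOME \<sigma>. bij_betw \<sigma> (A K) (B K))"
    have S: "bij_betw (S (C c)) (A (C c)) (B (C c))" for c
      unfolding S_def by (rule someI_ex[OF ex])
    define \<sigma> where "\<sigma> = (\<lambda>a. S (C (fst a)) a)"
    have CC: "C z = C c" if "z \<in> C c" for z c
      using that connected_component_eq[of z U c] by (simp add: C_def)
    have bij: "bij_betw \<sigma> (A K) (B K)" if K: "K \<in> C ` U" for K
    proof -
      obtain c where c: "K = C c" using K by blast
      have "bij_betw (S K) (A K) (B K) \<longleftrightarrow> bij_betw \<sigma> (A K) (B K)"
        by (rule bij_betw_cong) (use CC in \<open>auto simp: \<sigma>_def A_def c\<close>)
      then show ?thesis using S c by simp
    qed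
    \<comment> \<open>The second claim makes the sets \<open>B K\<close> exhaust the zeros: moving a
      zero back by \<open>\<tau>\<close> changes the value by less than \<open>d/2\<close>.\<close>
    have inU: "fst a \<in> U" "fst a - \<tau> \<in> U" if a: "a \<in> zero_list f" for a
    proof -
      have 0: "spherical f (fst a) = 0" using a by (auto simp: zero_list_def spherical_nonpole)
      then show "fst a \<in> U" using d(1) by (simp add: U_def)
      have "dist (spherical f (fst a - \<tau> + \<tau>)) (spherical f (fst a - \<tau>)) < d/2"
        using \<tau> unfolding almost_period_spherical by blast
      then show "fst a - \<tau> \<in> U" using 0 d(1) by (simp add: U_def)
    qed
    have "(\<Union>K\<in>C ` U. A K) = zero_list f" "(\<Union>K\<in>C ` U. B K) = zero_list f"
    proof -
      have "a \<in> (\<Union>K\<in>C ` U. A K) \<and> a \<in> (\<Union>K\<in>C ` U. B K)" if "a \<in> zero_list f" for a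
      proof
        show "a \<in> (\<Union>K\<in>C ` U. A K)"
          by (rule UN_I[of "C (fst a)"]) (use that inU Cc in \<open>auto simp: A_def\<close>)
        show "a \<in> (\<Union>K\<in>C ` U. B K)"
          by (rule UN_I[of "C (fst a - \<tau>)"]) (use that inU Cc in \<open>auto simp: B_def\<close>)
      qed
      moreover have "A K \<subseteq> zero_list f" "B K \<subseteq> zero_list f" for K by (auto simp: A_def B_def)
      ultimately show "(\<Union>K\<in>C ` U. A K) = zero_list f" "(\<Union>K\<in>C ` U. B K) = zero_list f"
        by blast+
    qed
    moreover have "disjoint_family_on B (C ` U)"
      unfolding disjoint_family_on_def
    proof (intro ballI impI)
      fix K K' assume "K \<in> C ` U" "K' \<in> C ` U" "K \<noteq> K'"
      then have "K \<inter> K' = {}" using CC by blast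
      then show "B K \<inter> B K' = {}" by (auto simp: B_def)
    qed
    ultimately have "bij_betw \<sigma> (zero_list f) (zero_list f)"
      using bij_betw_UNION_disjoint[of B "C ` U" \<sigma> A] bij by simp
    \<comment> \<open>The zero and its image moved back by \<open>\<tau>\<close> lie in the same
      component, so \<open>diam\<close> bounds their distance.\<close>
    moreover have "cmod (fst a + \<tau> - fst (\<sigma> a)) < e" if a: "a \<in> zero_list f" for a
    proof -
      have aA: "a \<in> A (C (fst a))" using a inU Cc by (simp add: A_def)
      then have "\<sigma> a \<in> B (C (fst a))" unfolding \<sigma>_def by (rule bij_betwE[OF S, THEN bspec])
      then have "dist (fst a) (fst (\<sigma> a) - \<tau>) < e"
        using aA by (intro diam) (auto simp: A_def B_def)
      then show ?thesis by (simp add: dist_norm algebra_simps)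
    qed
    ultimately show "\<exists>\<sigma>. bij_betw \<sigma> (zero_list f) (zero_list f) \<and>
        (\<forall>a\<in>zero_list f. cmod (fst a + \<tau> - fst (\<sigma> a)) < e)" by blast
  qed
qed

section \<open>Poles as zeros of the reciprocal\<close>

text \<open>The value 0 at a pole of \<open>f\<close> is the continuous extension. At a zero of
  \<open>f\<close> the value \<open>inverse 0 = 0\<close> is junk, harmless because that point
  becomes a pole.\<close>

definition reciprocal :: "(complex \<Rightarrow> complex) \<Rightarrow> complex \<Rightarrow> complex" where
  "reciprocal f z = (if z \<in> poles f then 0 else inverse (f z))"

definition sphere_inverse :: "complex option \<Rightarrow> complex option" where
  "sphere_inverse x = (case x of None \<Rightarrow> Some 0 | Some a \<Rightarrow> if a = 0 then None else Some (inverse a))"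

lemma sphere_inverse_simps [simp]:
  "sphere_inverse None = Some 0" "sphere_inverse (Some 0) = None"
  "a \<noteq> 0 \<Longrightarrow> sphere_inverse (Some a) = Some (inverse a)"
  by (simp_all add: sphere_inverse_def)

lemma sphere_inverse_involution [simp]: "sphere_inverse (sphere_inverse x) = x"
  by (auto simp: sphere_inverse_def split: option.split)

lemma rho_S_commute: "rho_S x y = rho_S y x"
  by (simp add: dist_commute flip: dist_sphere_pt)

text \<open>Inversion is a rotation of the sphere, so \<open>f\<close> and its reciprocal have the
  same almost periods. By \<open>sq\<close>, the moduli that inversion introduces in the
  denominators cancel those in the difference of the inverses.\<close>

lemma rho_S_sphere_inverse: "rho_S (sphere_inverse x) (sphere_inverse y) = rho_S x y"
proof -
  have sq: "sqrt (1 + (cmod (inverse a))\<^sup>2) = sqrt (1 + (cmod a)\<^sup>2) / cmod a" if "a \<noteq> 0" for a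
  proof -
    have "1 + (cmod (inverse a))\<^sup>2 = (1 + (cmod a)\<^sup>2) / (cmod a)\<^sup>2"
      using that by (simp add: norm_inverse power_inverse add_divide_distrib inverse_eq_divide norm_divide power_divide)
    then show ?thesis by (simp add: real_sqrt_divide)
  qed
  have pos: "sqrt (1 + (cmod a)\<^sup>2) > 0" for a by (simp add: one_plus_square_pos)
  have *: "rho_S (sphere_inverse None) (sphere_inverse (Some b)) = rho_S None (Some b)" for b
  proof (cases "b = 0")
    case False
    have "rho_S (sphere_inverse None) (sphere_inverse (Some b)) = cmod (inverse b) / (sqrt (1 + (cmod b)\<^sup>2) / cmod b)"
      unfolding sphere_inverse_simps(1) sphere_inverse_simps(3)[OF False]
      by (simp only: rho_S.simps sq[OF False]) simp
    also have "\<dots> = 1 / sqrt (1 + (cmod b)\<^sup>2)" using False by (simp add: norm_inverse divide_inverse)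
    finally show ?thesis by simp
  qed simp
  have **: "rho_S (sphere_inverse (Some 0)) (sphere_inverse (Some b)) = rho_S (Some 0) (Some b)" for b
  proof (cases "b = 0")
    case False
    have "rho_S (sphere_inverse (Some 0)) (sphere_inverse (Some b)) = 1 / (sqrt (1 + (cmod b)\<^sup>2) / cmod b)"
      unfolding sphere_inverse_simps(2) sphere_inverse_simps(3)[OF False]
      by (simp only: rho_S.simps sq[OF False])
    then show ?thesis by simp
  qed simp
  have ***: "rho_S (sphere_inverse (Some a)) (sphere_inverse (Some b)) = rho_S (Some a) (Some b)"
    if "a \<noteq> 0" "b \<noteq> 0" for a b
  proof -
    have "inverse a - inverse b = (b - a) / (a * b)" using that by (simp add: field_simps)
    then have "cmod (inverse a - inverse b) = cmod (a - b) / (cmod a * cmod b)"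
      by (simp add: norm_divide norm_mult norm_minus_commute)
    then show ?thesis
      unfolding sphere_inverse_simps(3)[OF that(1)] sphere_inverse_simps(3)[OF that(2)] rho_S.simps
        sq[OF that(1)] sq[OF that(2)]
      using that by simp
  qed
  show ?thesis
  proof (cases x)
    case None
    then show ?thesis using * by (cases y) simp_all
  next
    case (Some a)
    show ?thesis
    proof (cases y)
      case None
      then show ?thesis using *[of a] Some rho_S_commute by metis
    next
      case (Some b)
      then show ?thesis
        using \<open>x = Some a\<close> **[of b] **[of a] ***[of a b] rho_S_commute by metis
    qed
  qed
qed

lemma eventually_not_pole: "meromorphic_C f \<Longrightarrow> \<forall>\<^sub>F w in at z. w \<notin> poles f"
  by (simp add: meromorphic_C_def islimpt_iff_eventually)

lemma isCont_nonpole: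
  assumes "meromorphic_C f" "z \<notin> poles f"
  shows "isCont f z"
proof -
  have "continuous_on (- poles f) f"
    using assms(1) by (simp add: meromorphic_C_def Compl_eq_Diff_UNIV holomorphic_on_imp_continuous_on)
  then show ?thesis
    using assms by (simp add: continuous_on_eq_continuous_at[OF open_nonpoles[OF assms(1)]])
qed

text \<open>The plane without the isolated poles is connected, so accumulating zeros force
  \<open>f\<close> to vanish off its poles. Near a pole \<open>f\<close> is nonzero, so there are
  then no poles, and \<open>f\<close> would be constant.\<close>

lemma eventually_nonzero:
  assumes f: "meromorphic_C f" and nonconst: "ext_val f u \<noteq> ext_val f v"
  shows "\<forall>\<^sub>F w in at z. f w \<noteq> 0"
proof (cases "z \<in> poles f")
  case True
  then have "filterlim f at_infinity (at z)" by (simp add: poles_def)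
  then show ?thesis by (rule filterlim_at_infinity_imp_eventually_ne)
next
  case False
  show ?thesis
  proof (rule ccontr)
    assume "\<not> ?thesis"
    then have "z islimpt {w. f w = 0}" by (simp add: islimpt_iff_eventually)
    \<comment> \<open>Values at poles are arbitrary, so poles are removed from the zero set before
      the identity theorem is used; as they do not accumulate, \<open>z\<close> remains a limit
      point.\<close>
    moreover have "\<not> z islimpt poles f" using f by (simp add: meromorphic_C_def)
    ultimately have lim: "z islimpt {w\<in>- poles f. f w = 0}"
      using islimpt_Un[of z "{w\<in>- poles f. f w = 0}" "poles f"]
        islimpt_subset[of z "{w. f w = 0}" "{w\<in>- poles f. f w = 0} \<union> poles f"] by auto
    have "poles f sparse_in UNIV"
      unfolding sparse_in_def using f by (auto simp: meromorphic_C_def)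
    then have "connected (UNIV - poles f)"
      by (intro sparse_imp_connected) auto
    then have f0: "f w = 0" if "w \<notin> poles f" for w
      using that False f lim open_nonpoles[OF f]
      by (intro analytic_continuation[of f "- poles f" "{w\<in>- poles f. f w = 0}" z w])
        (auto simp: meromorphic_C_def Compl_eq_Diff_UNIV)
    have "p \<notin> poles f" for p
    proof
      assume "p \<in> poles f"
      then have "filterlim f at_infinity (at p)" by (simp add: poles_def)
      then have "\<forall>\<^sub>F w in at p. f w \<noteq> 0" by (rule filterlim_at_infinity_imp_eventually_ne)
      with eventually_not_pole[OF f, of p] have "\<forall>\<^sub>F w in at p. False"
        by eventually_elim (use f0 in blast)
      then show False by simp
    qed
    then show False using nonconst f0 by (simp add: ext_val_def)
  qed
qed

lemma
  assumes f: "meromorphic_C f" and nonconst: "ext_val f u \<noteq> ext_val f v"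
  shows poles_reciprocal: "poles (reciprocal f) = {z. z \<notin> poles f \<and> f z = 0}"
    and meromorphic_reciprocal: "meromorphic_C (reciprocal f)"
proof -
  have ev: "\<forall>\<^sub>F w in at z. inverse (f w) = reciprocal f w" for z
    using eventually_not_pole[OF f, of z] by eventually_elim (simp add: reciprocal_def)
  have pole: "(reciprocal f \<longlongrightarrow> 0) (at z)" if "z \<in> poles f" for z
  proof -
    have "filterlim f at_infinity (at z)" using that by (simp add: poles_def)
    then have "((\<lambda>w. inverse (f w)) \<longlongrightarrow> 0) (at z)" by (rule filterlim_compose[OF tendsto_inverse_0])
    then show ?thesis by (rule tendsto_cong[OF ev, THEN iffD1])
  qed
  have nonzero: "(reciprocal f \<longlongrightarrow> inverse (f z)) (at z)" if "z \<notin> poles f" "f z \<noteq> 0" for z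
  proof -
    have "((\<lambda>w. inverse (f w)) \<longlongrightarrow> inverse (f z)) (at z)"
      using isCont_nonpole[OF f that(1)] that(2) unfolding isCont_def by (rule tendsto_inverse)
    then show ?thesis by (rule tendsto_cong[OF ev, THEN iffD1])
  qed
  have zero: "filterlim (reciprocal f) at_infinity (at z)" if "z \<notin> poles f" "f z = 0" for z
  proof -
    have "(f \<longlongrightarrow> 0) (at z)"
      using isCont_nonpole[OF f that(1)] that(2) unfolding isCont_def by simp
    \<comment> \<open>Because \<open>inverse 0 = 0\<close>, it is essential that \<open>f\<close>
      approaches 0 without taking the value 0 near \<open>z\<close>; this is where nonconstancy
      enters.\<close>
    then have "filterlim f (at 0) (at z)"
      using eventually_nonzero[OF f nonconst, of z] by (intro filterlim_atI) 
    then have "filterlim (\<lambda>w. inverse (f w)) at_infinity (at z)"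
      by (rule filterlim_compose[OF filterlim_inverse_at_infinity])
    then show ?thesis by (rule filterlim_cong[OF refl refl ev, THEN iffD1])
  qed
  have not_pole: "z \<notin> poles (reciprocal f)" if "(reciprocal f \<longlongrightarrow> l) (at z)" for z l
    using not_tendsto_and_filterlim_at_infinity[OF _ that] by (auto simp: poles_def)
  show poles_eq: "poles (reciprocal f) = {z. z \<notin> poles f \<and> f z = 0}"
  proof (intro equalityI subsetI)
    fix z assume z: "z \<in> poles (reciprocal f)"
    have "z \<notin> poles f" using not_pole[OF pole] z by blast
    moreover have "f z = 0" using not_pole[OF nonzero] z calculation by blast
    ultimately show "z \<in> {z. z \<notin> poles f \<and> f z = 0}" by simp
  next
    fix z assume "z \<in> {z. z \<notin> poles f \<and> f z = 0}"
    then show "z \<in> poles (reciprocal f)" using zero by (simp add: poles_def)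
  qed
  define W where "W = {w\<in>- poles f. f w \<noteq> 0}"
  have holf: "f holomorphic_on - poles f"
    using f by (simp add: meromorphic_C_def Compl_eq_Diff_UNIV)
  have W: "open W"
    unfolding W_def
    using continuous_open_preimage[OF holomorphic_on_imp_continuous_on[OF holf] open_nonpoles[OF f], of "- {0}"]
    by (simp add: vimage_def Int_def open_Compl)
  have "(\<lambda>w. inverse (f w)) holomorphic_on W"
    by (intro holomorphic_intros holomorphic_on_subset[OF holf]) (auto simp: W_def)
  then have holW: "reciprocal f holomorphic_on W"
    by (rule holomorphic_transform) (simp add: reciprocal_def W_def)
  have diff: "reciprocal f field_differentiable at z" if z: "z \<notin> poles (reciprocal f)" for z
  proof (cases "z \<in> poles f")
    case False
    then have "z \<in> W" using z poles_eq by (simp add: W_def)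
    then show ?thesis using holW W holomorphic_on_imp_differentiable_at by blast
  next
    case True
    \<comment> \<open>At a pole of \<open>f\<close> the reciprocal has a removable singularity: it
      is holomorphic on a punctured disc and continuous at the centre.\<close>
    have "\<forall>\<^sub>F w in at z. w \<in> W"
      using eventually_not_pole[OF f, of z] eventually_nonzero[OF f nonconst, of z]
      by eventually_elim (simp add: W_def)
    then obtain r where r: "r > 0" "\<And>w. w \<in> ball z r \<Longrightarrow> w \<noteq> z \<Longrightarrow> w \<in> W"
      unfolding eventually_at by (auto simp: dist_commute)
    have h: "reciprocal f holomorphic_on ball z r - {z}"
      by (rule holomorphic_on_subset[OF holW]) (use r(2) in blast)
    have "isCont (reciprocal f) w" if "w \<in> ball z r" for w
    proof (cases "w = z")
      case True
      then show ?thesis using pole[OF \<open>z \<in> poles f\<close>] \<open>z \<in> poles f\<close>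
        by (simp add: isCont_def reciprocal_def)
    next
      case False
      then have "w \<in> W" using r that by blast
      then show ?thesis
        using holomorphic_on_imp_continuous_on[OF holW] W continuous_on_eq_continuous_at by blast
    qed
    then have "continuous_on (ball z r) (reciprocal f)"
      by (simp add: continuous_at_imp_continuous_on)
    then have "reciprocal f holomorphic_on ball z r"
      by (rule no_isolated_singularity[OF _ h]) auto
    then show ?thesis
      using r(1) by (intro holomorphic_on_imp_differentiable_at[of _ "ball z r"]) auto
  qed
  have "reciprocal f holomorphic_on UNIV - poles (reciprocal f)"
    unfolding holomorphic_on_def using diff by (auto intro: field_differentiable_at_within)
  moreover have "\<not> z islimpt poles (reciprocal f)" for z
  proof -
    have "\<forall>\<^sub>F w in at z. w \<notin> poles (reciprocal f)"
      using eventually_nonzero[OF f nonconst, of z] by eventually_elim (simp add: poles_eq)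
    then show ?thesis by (simp add: islimpt_iff_eventually)
  qed
  ultimately show "meromorphic_C (reciprocal f)" by (simp add: meromorphic_C_def)
qed

text \<open>Inverting \<open>g\<close> exchanges the factorizations of \<open>f\<close> and of its
  reciprocal, with the same exponent, once the disc is shrunk so that \<open>g\<close> has no zeros
  and \<open>f\<close> no other poles in it.\<close>

lemma pole_mult_eq_zero_mult_reciprocal:
  assumes f: "meromorphic_C f" and z: "z \<in> poles f"
  shows "pole_mult f z = zero_mult (reciprocal f) z"
proof -
  have inf: "filterlim f at_infinity (at z)" using z by (simp add: poles_def)
  define Q where "Q = (\<lambda>n r g. r > 0 \<and> g holomorphic_on ball z r \<and> g z \<noteq> 0 \<and>
                        (\<forall>w\<in>ball z r - {z}. f w = g w / (w - z) ^ n))"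
  define P where "P = (\<lambda>n r g. r > 0 \<and> g holomorphic_on ball z r \<and> g z \<noteq> 0 \<and>
                        (\<forall>w\<in>ball z r. reciprocal f w = (w - z) ^ n * g w))"
  have shrink: "\<exists>r'>0. r' \<le> r \<and> (\<forall>w\<in>ball z r'. g w \<noteq> 0 \<and> (w \<noteq> z \<longrightarrow> w \<notin> poles f))"
    if "r > 0" "g holomorphic_on ball z r" "g z \<noteq> 0" for r g
  proof -
    have "isCont g z"
      using holomorphic_on_imp_continuous_on[OF that(2)] that(1)
      by (simp add: continuous_on_eq_continuous_at)
    then have "\<forall>\<^sub>F w in at z. g w \<noteq> 0"
      using that(3) tendsto_imp_eventually_ne unfolding isCont_def by blast
    with eventually_not_pole[OF f, of z] have "\<forall>\<^sub>F w in at z. w \<notin> poles f \<and> g w \<noteq> 0"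
      by eventually_elim simp
    then obtain d where d: "d > 0" "\<And>w. w \<noteq> z \<Longrightarrow> dist w z < d \<Longrightarrow> w \<notin> poles f \<and> g w \<noteq> 0"
      unfolding eventually_at by auto
    have "g w \<noteq> 0 \<and> (w \<noteq> z \<longrightarrow> w \<notin> poles f)" if "w \<in> ball z (min d r)" for w
      using that d(2)[of w] \<open>g z \<noteq> 0\<close> by (cases "w = z") (auto simp: dist_commute)
    then show ?thesis
      using that(1) d(1) by (intro exI[of _ "min d r"]) auto
  qed
  have hol_inv: "(\<lambda>w. inverse (g w)) holomorphic_on ball z r'"
    if "g holomorphic_on ball z r" "r' \<le> r" "\<forall>w\<in>ball z r'. g w \<noteq> 0 \<and> (w \<noteq> z \<longrightarrow> w \<notin> poles f)" for g r r'
    by (intro holomorphic_intros holomorphic_on_subset[OF that(1)]) (use that in auto)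
  have QP: "\<exists>r g. P n r g" if "Q n r g" for n r g
  proof -
    note Q = that[unfolded Q_def]
    obtain r' where r': "r' > 0" "r' \<le> r" "\<forall>w\<in>ball z r'. g w \<noteq> 0 \<and> (w \<noteq> z \<longrightarrow> w \<notin> poles f)"
      using shrink[of r g] Q by blast
    \<comment> \<open>The factorization of the reciprocal must hold at the centre too, where its
      value is 0; this needs a positive exponent. Exponent 0 would give \<open>f\<close> a finite
      limit at its pole.\<close>
    have "n \<noteq> 0"
    proof
      assume "n = 0"
      have "\<forall>\<^sub>F w in at z. w \<in> ball z r - {z}"
        using Q by (intro eventually_at_in_open) auto
      then have ev: "\<forall>\<^sub>F w in at z. g w = f w"
        by eventually_elim (use Q \<open>n = 0\<close> in simp)
      have "isCont g z"
        using Q holomorphic_on_imp_continuous_on[of g "ball z r"]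
        by (simp add: continuous_on_eq_continuous_at)
      then have "(f \<longlongrightarrow> g z) (at z)"
        unfolding isCont_def by (rule tendsto_cong[OF ev, THEN iffD1])
      then show False using inf not_tendsto_and_filterlim_at_infinity[of "at z" f "g z"] by simp
    qed
    moreover have "reciprocal f w = (w - z) ^ n * inverse (g w)" if "w \<in> ball z r'" "w \<noteq> z" for w
    proof -
      have "w \<in> ball z r - {z}" "w \<notin> poles f" using that r' by auto
      then show ?thesis using Q by (simp add: reciprocal_def divide_inverse)
    qed
    ultimately have "reciprocal f w = (w - z) ^ n * inverse (g w)" if "w \<in> ball z r'" for w
      using that z by (cases "w = z") (simp_all add: reciprocal_def)
    then have "P n r' (\<lambda>w. inverse (g w))"
      unfolding P_def using r' Q hol_inv[of g r r'] by auto
    then show ?thesis by blast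
  qed
  have PQ: "\<exists>r g. Q n r g" if "P n r g" for n r g
  proof -
    note P = that[unfolded P_def]
    obtain r' where r': "r' > 0" "r' \<le> r" "\<forall>w\<in>ball z r'. g w \<noteq> 0 \<and> (w \<noteq> z \<longrightarrow> w \<notin> poles f)"
      using shrink[of r g] P by blast
    have "f w = inverse (g w) / (w - z) ^ n" if w: "w \<in> ball z r' - {z}" for w
    proof -
      have "w \<in> ball z r" "w \<notin> poles f" using w r' by auto
      then have "inverse (f w) = (w - z) ^ n * g w" using P reciprocal_def[of f w] by auto
      then have "f w = inverse ((w - z) ^ n * g w)" by (metis inverse_inverse_eq)
      then show ?thesis by (simp add: divide_inverse)
    qed
    then have "Q n r' (\<lambda>w. inverse (g w))"
      unfolding Q_def using r' P hol_inv[of g r r'] by auto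
    then show ?thesis by blast
  qed
  have "(\<lambda>n. \<exists>r g. Q n r g) = (\<lambda>n. \<exists>r g. P n r g)"
    by (intro ext iffI; elim exE) (rule QP PQ, assumption)+
  then have "(THE n. \<exists>r g. Q n r g) = (THE n. \<exists>r g. P n r g)" by simp
  then show ?thesis unfolding pole_mult_def zero_mult_def P_def Q_def by simp
qed

lemma ext_val_reciprocal:
  assumes f: "meromorphic_C f" and nonconst: "ext_val f u \<noteq> ext_val f v"
  shows "ext_val (reciprocal f) z = sphere_inverse (ext_val f z)"
  using poles_reciprocal[OF assms] by (simp add: ext_val_def reciprocal_def)

lemma
  assumes f: "f \<in> AE_class"
  shows almost_period_reciprocal: "almost_period (reciprocal f) e \<tau> \<longleftrightarrow> almost_period f e \<tau>"
    and AE_class_reciprocal: "reciprocal f \<in> AE_class"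
    and pole_list_eq_zero_list_reciprocal: "pole_list f = zero_list (reciprocal f)"
proof -
  have mero: "meromorphic_C f" by (rule AE_class_meromorphic[OF f])
  obtain u v where uv: "ext_val f u \<noteq> ext_val f v" using f by (auto simp: AE_class_def)
  note ext = ext_val_reciprocal[OF mero uv]
  show ap: "almost_period (reciprocal f) e \<tau> \<longleftrightarrow> almost_period f e \<tau>" for e \<tau>
    by (simp add: almost_period_def ext rho_S_sphere_inverse)
  have "ext_val (reciprocal f) u \<noteq> ext_val (reciprocal f) v"
    unfolding ext using uv by (metis sphere_inverse_involution)
  then have nc: "\<exists>z w. ext_val (reciprocal f) z \<noteq> ext_val (reciprocal f) w" by blast
  have "\<forall>\<epsilon>>0. rel_dense {\<tau>. almost_period f \<epsilon> \<tau>}"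
    using f unfolding AE_class_def by (elim CollectE conjE)
  then have "\<forall>\<epsilon>>0. rel_dense {\<tau>. almost_period (reciprocal f) \<epsilon> \<tau>}"
    unfolding ap .
  with meromorphic_reciprocal[OF mero uv] nc show "reciprocal f \<in> AE_class"
    unfolding AE_class_def by (intro CollectI conjI)
  show "pole_list f = zero_list (reciprocal f)"
    using pole_mult_eq_zero_mult_reciprocal[OF mero] poles_reciprocal[OF mero uv]
    by (auto simp: pole_list_def zero_list_def reciprocal_def split: if_splits)
qed

section \<open>Common almost periods of the function and its divisor\<close>

theorem mainTheorem7:
  fixes f :: "complex \<Rightarrow> complex"
  assumes "f \<in> AE_class"
  shows "almost_periodic_divisor f \<and>
         (\<forall>\<epsilon>>0. rel_dense {\<tau>. almost_period f \<epsilon> \<tau> \<and> div_almost_period f \<epsilon> \<tau>})"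
proof -
  have joint: "rel_dense {\<tau>. almost_period f \<epsilon> \<tau> \<and> div_almost_period f \<epsilon> \<tau>}" if \<epsilon>: "\<epsilon> > 0" for \<epsilon>
  proof -
    obtain d1 where d1: "d1 > 0" "\<And>\<tau>. almost_period f d1 \<tau> \<Longrightarrow>
      \<exists>\<sigma>. bij_betw \<sigma> (zero_list f) (zero_list f) \<and> (\<forall>a\<in>zero_list f. cmod (fst a + \<tau> - fst (\<sigma> a)) < \<epsilon>)"
      using AE_class_zero_list_almost_period[OF assms \<epsilon>] by blast
    obtain d2 where d2: "d2 > 0" "\<And>\<tau>. almost_period f d2 \<tau> \<Longrightarrow>
      \<exists>\<sigma>. bij_betw \<sigma> (pole_list f) (pole_list f) \<and> (\<forall>a\<in>pole_list f. cmod (fst a + \<tau> - fst (\<sigma> a)) < \<epsilon>)"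
      using AE_class_zero_list_almost_period[OF AE_class_reciprocal[OF assms] \<epsilon>]
      unfolding almost_period_reciprocal[OF assms] pole_list_eq_zero_list_reciprocal[OF assms] by blast
    \<comment> \<open>Including \<open>\<epsilon>\<close> makes the same \<open>\<tau>\<close> an
      \<open>\<epsilon>\<close>-almost period of \<open>f\<close>; \<open>d1\<close> and
      \<open>d2\<close> handle zeros and poles.\<close>
    define d where "d = min \<epsilon> (min d1 d2)"
    have mono: "almost_period f e \<tau>" if "almost_period f d \<tau>" "d \<le> e" for e \<tau>
      using that unfolding almost_period_def by (meson less_le_trans)
    have "almost_period f \<epsilon> \<tau> \<and> div_almost_period f \<epsilon> \<tau>" if "almost_period f d \<tau>" for \<tau>
      unfolding div_almost_period_def
      using d1(2)[of \<tau>] d2(2)[of \<tau>] mono[OF that] by (simp add: d_def)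
    moreover have "d > 0" using \<epsilon> d1(1) d2(1) by (simp add: d_def)
    then obtain L where "\<forall>c. \<exists>\<tau>\<in>ball c L. almost_period f d \<tau>"
      using AE_class_almost_periods[OF assms] by blast
    ultimately show ?thesis unfolding rel_dense_def by (intro exI[of _ L]) blast
  qed
  then have "rel_dense {\<tau>. div_almost_period f \<epsilon> \<tau>}" if "\<epsilon> > 0" for \<epsilon>
    using that unfolding rel_dense_def by (smt (verit, best) disjoint_iff mem_Collect_eq)
  with joint show ?thesis by (simp add: almost_periodic_divisor_def)
qed

end
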